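(* Let $X\in{}^{\omega}2$. A relation $R$ on $\omega$ is feedback computable in $X$ if and only if both $R$ and its complement $\neg R$ are feedback semi-computable in $X$. Moreover, a code for $R$ as a feedback computable relation is effectively obtainable from any pair of codes for $R$ and $\neg R$ as feedback semi-computable relations: there is a recursive function $h:\omega\times\omega\to\omega$ such that whenever $e_0$ is a code for $R$ and $e_1$ is a code for $\neg R$ as relations feedback semi-computable in $X$, then $h(e_0,e_1)$ is a code for $R$ as a relation feedback computable in $X$.
   Context: **Feedback computation.** Programs are ordinary oracle Turing machine programs (with oracle $X$), indexed by $e\in\omega$ in a standard way, with an additional instruction allowing the machine at any stage to issue a query $Q^X(e',m')$, with $e',m'$ integers computed by the machine, asking whether the feedback computation $\langle e'\rangle^X(m')$ converges or diverges, and receiving (in one step) an answer in $\{\downarrow,\uparrow\}$. Finite sequences of integers are coded by integers, so an input $m$ may be a tuple. Formally, for a partial function $C$ let $I(C)$ be the set of pairs $\langle\langle e,m,X\rangle,\langle j,k\rangle\rangle$ such that program $e$, run on input $m$ with oracle $X$, makes only queries $Q^X(e',m')$ for which $C(\langle e',m',X\rangle)=\langle j',k'\rangle$ is defined, each such query being answered by $j'$, and either this run halts with output $k\in\omega$ and $j=\,\downarrow$, or it runs forever and $j=\,\uparrow$, $k=\omega$. Let $I_\infty$ be the least fixed point of the monotone operator $I$, obtained by iteration from $\emptyset$. Write $\langle e\rangle^X(m)\downarrow k$ iff $I_\infty(\langle e,m,X\rangle)=\langle\downarrow,k\rangle$, and $\langle e\rangle^X(m)\downarrow$ iff this holds for some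 $k\in\omega$. A relation $R$ is feedback semi-computable in $X$, with code (index) $e$, if $R=\{m\mid\langle e\rangle^X(m)\downarrow\}$. It is feedback computable in $X$, with code (index) $e$, if for all $m$, $\langle e\rangle^X(m)\downarrow K_R(m)$, where $K_R$ is the characteristic function of $R$ ($1$ on $R$, $0$ off $R$). *)

theory Defs
  imports "HOL-Library.Nat_Bijection" "HOL-Library.Extended_Nat"
begin

section \<open>Tapes\<close>

text \<open>
  Tapes are two-way infinite over the alphabet \<open>{blank, 1}\<close>, with \<^term>\<open>True\<close> as the symbol 1.
  In \<open>(ls, rs)\<close> the list \<open>rs\<close> holds the scanned cell and the cells to its right, and \<open>ls\<close> the
  cells to the left, nearest first; all cells beyond the two lists are blank. The integer
  written on a tape is its number of 1s.
\<close>

type_synonym tape = "bool list \<times> bool list"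

datatype dir = Lft | Rgt | Stay

definition hd_blank :: "bool list \<Rightarrow> bool" where
  "hd_blank bs = (case bs of [] \<Rightarrow> False | b # _ \<Rightarrow> b)"

fun scanned :: "tape \<Rightarrow> bool" where
  "scanned (ls, rs) = hd_blank rs"

fun write_cell :: "bool \<Rightarrow> tape \<Rightarrow> tape" where
  "write_cell b (ls, rs) = (ls, b # tl rs)"

fun move_head :: "dir \<Rightarrow> tape \<Rightarrow> tape" where
  "move_head Lft (ls, rs) = (tl ls, hd_blank ls # rs)"
| "move_head Rgt (ls, rs) = (hd_blank rs # ls, tl rs)"
| "move_head Stay (ls, rs) = (ls, rs)"

fun ones :: "tape \<Rightarrow> nat" where
  "ones (ls, rs) = count_list ls True + count_list rs True"


section \<open>Programs and their indices\<close>

text \<open>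
  A program is the table of a multi-tape oracle Turing machine: its \<open>q\<close>-th entry is the
  instruction for state \<open>q\<close>, the initial state is 0, and the machine halts on reaching a state
  without an instruction.
  \<^item> \<open>Act t (w, d, q) (w', d', q')\<close>: if tape \<open>t\<close> scans a blank, write \<open>w\<close>, move \<open>d\<close>, go to
    state \<open>q\<close>; if it scans a 1, do the same with the primed entries.
  \<^item> \<open>Oracle t q q'\<close>: with \<open>n\<close> the integer on tape \<open>t\<close>, go to \<open>q\<close> if \<open>X(n) = 1\<close> and to
    \<open>q'\<close> if \<open>X(n) = 0\<close>.
  \<^item> \<open>Query t u q q'\<close>: with \<open>e'\<close>, \<open>m'\<close> the integers on tapes \<open>t\<close>, \<open>u\<close>, ask whether the feedback
    computation of \<open>e'\<close> on \<open>m'\<close> converges (go to \<open>q\<close>) or diverges (go to \<open>q'\<close>).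
\<close>

type_synonym action = "bool \<times> dir \<times> nat"

datatype instr =
    Act nat action action
  | Oracle nat nat nat
  | Query nat nat nat nat

type_synonym program = "instr list"

definition decode_dir :: "nat \<Rightarrow> dir" where
  "decode_dir n = (if n mod 3 = 0 then Lft else if n mod 3 = 1 then Rgt else Stay)"

definition decode_action :: "nat \<Rightarrow> action" where
  "decode_action n =
     (let (b, n') = prod_decode n; (d, q) = prod_decode n' in (odd b, decode_dir d, q))"

definition decode_instr :: "nat \<Rightarrow> instr" where
  "decode_instr n =
     (let (a, b) = prod_decode (n div 3); (c, d) = prod_decode b in
      if n mod 3 = 0 then Act a (decode_action c) (decode_action d)
      else if n mod 3 = 1 then Oracle a c d
      else (let (d1, d2) = prod_decode d in Query a c d1 d2))"

definition program_of :: "nat \<Rightarrow> program" where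
  "program_of e = map decode_instr (list_decode e)"


section \<open>Feedback computation\<close>

datatype answer = Down | Up

text \<open>
  A partial function \<open>C\<close> taking \<open>\<langle>e, m, X\<rangle>\<close> to \<open>\<langle>j, k\<rangle>\<close> is given by its graph. The value
  \<open>k = \<omega>\<close> of a divergent computation is \<^term>\<open>\<infinity>\<close> of type \<^typ>\<open>enat\<close>.
\<close>

type_synonym oracle_set = "nat \<Rightarrow> bool"
type_synonym outcomes = "((nat \<times> nat \<times> oracle_set) \<times> (answer \<times> enat)) set"
type_synonym config = "nat \<times> (nat \<Rightarrow> tape)"

text \<open>A configuration about to make a query on which \<open>C\<close> is undefined has no successor, and it is
  not a halting configuration either.\<close>

inductive step :: "outcomes \<Rightarrow> oracle_set \<Rightarrow> program \<Rightarrow> config \<Rightarrow> config \<Rightarrow> bool"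
  for C :: outcomes and X :: oracle_set and P :: program where
  step_act:
    "\<lbrakk>q < length P; P ! q = Act t a\<^sub>0 a\<^sub>1;
      (w, d, q') = (if scanned (ts t) then a\<^sub>1 else a\<^sub>0)\<rbrakk>
     \<Longrightarrow> step C X P (q, ts) (q', ts(t := move_head d (write_cell w (ts t))))"
| step_oracle:
    "\<lbrakk>q < length P; P ! q = Oracle t q\<^sub>1 q\<^sub>0\<rbrakk>
     \<Longrightarrow> step C X P (q, ts) (if X (ones (ts t)) then q\<^sub>1 else q\<^sub>0, ts)"
| step_query:
    "\<lbrakk>q < length P; P ! q = Query t u q\<^sub>d q\<^sub>u;
      ((ones (ts t), ones (ts u), X), (j, k)) \<in> C\<rbrakk>
     \<Longrightarrow> step C X P (q, ts) (case j of Down \<Rightarrow> q\<^sub>d | Up \<Rightarrow> q\<^sub>u, ts)"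

text \<open>The input is written in unary on tape 0, from the scanned cell rightwards; the output is the
  integer on tape 0.\<close>

definition init_config :: "nat \<Rightarrow> config" where
  "init_config m = (0, (\<lambda>_. ([], []))(0 := ([], replicate m True)))"

definition halts_with :: "outcomes \<Rightarrow> oracle_set \<Rightarrow> program \<Rightarrow> nat \<Rightarrow> nat \<Rightarrow> bool" where
  "halts_with C X P m k \<longleftrightarrow>
     (\<exists>q ts. (step C X P)\<^sup>*\<^sup>* (init_config m) (q, ts) \<and> length P \<le> q \<and> ones (ts 0) = k)"

definition runs_forever :: "outcomes \<Rightarrow> oracle_set \<Rightarrow> program \<Rightarrow> nat \<Rightarrow> bool" where
  "runs_forever C X P m \<longleftrightarrow>
     (\<exists>c. c 0 = init_config m \<and> (\<forall>n::nat. step C X P (c n) (c (Suc n))))"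

definition fb_op :: "outcomes \<Rightarrow> outcomes" where
  "fb_op C =
     {((e, m, X), (Down, enat k)) | e m X k. halts_with C X (program_of e) m k} \<union>
     {((e, m, X), (Up, \<infinity>)) | e m X. runs_forever C X (program_of e) m}"

definition I_infty :: outcomes where
  "I_infty = lfp fb_op"

definition fb_converges_to :: "oracle_set \<Rightarrow> nat \<Rightarrow> nat \<Rightarrow> nat \<Rightarrow> bool" where
  "fb_converges_to X e m k \<longleftrightarrow> ((e, m, X), (Down, enat k)) \<in> I_infty"

definition fb_converges :: "oracle_set \<Rightarrow> nat \<Rightarrow> nat \<Rightarrow> bool" where
  "fb_converges X e m \<longleftrightarrow> (\<exists>k. fb_converges_to X e m k)"

definition fb_semicomputable_code :: "oracle_set \<Rightarrow> nat \<Rightarrow> nat set \<Rightarrow> bool" where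
  "fb_semicomputable_code X e R \<longleftrightarrow> R = {m. fb_converges X e m}"

definition fb_computable_code :: "oracle_set \<Rightarrow> nat \<Rightarrow> nat set \<Rightarrow> bool" where
  "fb_computable_code X e R \<longleftrightarrow> (\<forall>m. fb_converges_to X e m (if m \<in> R then 1 else 0))"

definition fb_semicomputable :: "oracle_set \<Rightarrow> nat set \<Rightarrow> bool" where
  "fb_semicomputable X R \<longleftrightarrow> (\<exists>e. fb_semicomputable_code X e R)"

definition fb_computable :: "oracle_set \<Rightarrow> nat set \<Rightarrow> bool" where
  "fb_computable X R \<longleftrightarrow> (\<exists>e. fb_computable_code X e R)"


section \<open>Well-definedness\<close>

text \<open>Every program has an index, the operator is monotone, and its least fixed point is (the
  graph of) a partial function.\<close>

lemma surj_decode_dir: "surj decode_dir"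
proof (rule surjI)
  show "decode_dir (case d of Lft \<Rightarrow> 0 | Rgt \<Rightarrow> 1 | Stay \<Rightarrow> 2) = d" for d
    by (cases d) (simp_all add: decode_dir_def)
qed

lemma surj_decode_action: "surj decode_action"
proof -
  have "\<exists>n. a = decode_action n" for a
  proof -
    obtain b d q where a: "a = (b, d, q)" by (cases a)
    obtain n where n: "d = decode_dir n" using surj_decode_dir by (blast dest: surjD)
    have "a = decode_action (prod_encode (of_bool b, prod_encode (n, q)))"
      by (simp add: a n decode_action_def)
    then show ?thesis ..
  qed
  then show ?thesis by (simp add: surj_def)
qed

lemma surj_decode_instr: "surj decode_instr"
proof -
  have "\<exists>n. i = decode_instr n" for i
  proof (cases i)
    case (Act t a a')
    obtain m n where "a = decode_action m" "a' = decode_action n"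
      using surj_decode_action by (meson surjD)
    then have "i = decode_instr (3 * prod_encode (t, prod_encode (m, n)))"
      by (simp add: Act decode_instr_def)
    then show ?thesis ..
  next
    case (Oracle t q q')
    have "(3 * x + 1) mod 3 = 1" "(3 * x + 1) div 3 = x" for x :: nat by presburger+
    then have "i = decode_instr (3 * prod_encode (t, prod_encode (q, q')) + 1)"
      by (simp add: Oracle decode_instr_def)
    then show ?thesis ..
  next
    case (Query t u q q')
    have "(3 * x + 2) mod 3 = 2" "(3 * x + 2) div 3 = x" for x :: nat by presburger+
    then have "i = decode_instr (3 * prod_encode (t, prod_encode (u, prod_encode (q, q'))) + 2)"
      by (simp add: Query decode_instr_def)
    then show ?thesis ..
  qed
  then show ?thesis by (simp add: surj_def)
qed

lemma surj_program_of: "surj program_of"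
proof -
  have "program_of = map decode_instr \<circ> list_decode" by (simp add: fun_eq_iff program_of_def)
  moreover have "surj (map decode_instr)"
    using surj_decode_instr by (metis lists_UNIV lists_image)
  ultimately show ?thesis using comp_surj[OF surj_list_decode] by metis
qed

lemma step_mono:
  assumes "C \<subseteq> D" "step C X P c c'"
  shows "step D X P c c'"
  using assms(2)
proof cases
  case step_act
  then show ?thesis by (simp add: step.step_act)
next
  case step_oracle
  then show ?thesis using step.step_oracle by blast
next
  case step_query
  then show ?thesis using step.step_query assms(1) by blast
qed

lemma mono_fb_op: "mono fb_op"
proof
  fix C D :: outcomes assume "C \<subseteq> D"
  then have *: "step C X P c c' \<Longrightarrow> step D X P c c'" for X P c c' by (rule step_mono)
  have le: "step C X P \<le> step D X P" for X P using * by (intro predicate2I)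
  have halts: "halts_with D X P m k" if "halts_with C X P m k" for X P m k
  proof -
    from that obtain q ts where "(step C X P)\<^sup>*\<^sup>* (init_config m) (q, ts)"
        "length P \<le> q" "ones (ts 0) = k"
      unfolding halts_with_def by (elim exE conjE)
    moreover from this(1) have "(step D X P)\<^sup>*\<^sup>* (init_config m) (q, ts)"
      by (rule predicate2D[OF rtranclp_mono[OF le]])
    ultimately show ?thesis
      unfolding halts_with_def by (intro exI conjI)
  qed
  have runs: "runs_forever D X P m" if "runs_forever C X P m" for X P m
  proof -
    from that obtain c where "c 0 = init_config m" "\<forall>n::nat. step C X P (c n) (c (Suc n))"
      unfolding runs_forever_def by (elim exE conjE)
    then show ?thesis
      unfolding runs_forever_def by (intro exI[of _ c] conjI allI) (simp_all add: *)
  qed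
  show "fb_op C \<subseteq> fb_op D"
    unfolding fb_op_def using halts runs by (auto 0 0)
qed

lemma I_infty_unfold: "I_infty = fb_op I_infty"
  unfolding I_infty_def by (rule lfp_unfold[OF mono_fb_op])

lemma step_deterministic:
  assumes "step C X P c c1" "step D X P c c2"
    and "\<forall>x v w. (x, v) \<in> C \<longrightarrow> (x, w) \<in> D \<longrightarrow> v = w"
  shows "c1 = c2"
  using assms(1)
proof cases
  case (step_act q t a0 a1 w d q' ts)
  from assms(2) show ?thesis
    by (cases rule: step.cases) (use step_act in \<open>auto simp: prod_eq_iff\<close>)
next
  case (step_oracle q t q1 q0 ts)
  from assms(2) show ?thesis
    by (cases rule: step.cases) (use step_oracle in auto)
next
  case (step_query q t u qd qu ts j k)
  from assms(2) obtain j' k' where "c2 = (case j' of Down \<Rightarrow> qd | Up \<Rightarrow> qu, ts)"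
    "((ones (ts t), ones (ts u), X), (j', k')) \<in> D"
    by (cases rule: step.cases) (use step_query in auto)
  with step_query assms(3) show ?thesis by fastforce
qed

lemma not_step_halted: "length P \<le> q \<Longrightarrow> \<not> step C X P (q, ts) c"
  by (auto elim: step.cases)

lemma halts_with_compatible:
  assumes CD: "\<forall>x v w. (x, v) \<in> C \<longrightarrow> (x, w) \<in> D \<longrightarrow> v = w"
    and "halts_with C X P m k" "halts_with D X P m l"
  shows "k = l"
proof -
  have "c1 = c2"
    if "(step C X P)\<^sup>*\<^sup>* c c1" "(step D X P)\<^sup>*\<^sup>* c c2" "length P \<le> fst c1" "length P \<le> fst c2"
    for c c1 c2
    using that
  proof (induction rule: converse_rtranclp_induct)
    case base
    then show ?case by (metis converse_rtranclpE not_step_halted prod.collapse)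
  next
    case (step c c')
    from step.prems(1) show ?case
    proof (cases rule: converse_rtranclpE)
      assume "c = c2"
      then show ?thesis using step by (metis not_step_halted prod.collapse)
    next
      fix c'' assume "step D X P c c''" and *: "(step D X P)\<^sup>*\<^sup>* c'' c2"
      then have "c' = c''" using step_deterministic[OF step.hyps(1) _ CD] by blast
      then show ?thesis using * step.IH step.prems by simp
    qed
  qed
  then show ?thesis using assms(2,3) unfolding halts_with_def by fastforce
qed

lemma halts_with_not_runs_forever:
  assumes CD: "\<forall>x v w. (x, v) \<in> C \<longrightarrow> (x, w) \<in> D \<longrightarrow> v = w"
    and "halts_with C X P m k"
  shows "\<not> runs_forever D X P m"
proof
  assume "runs_forever D X P m"
  then obtain c :: "nat \<Rightarrow> config" where c: "c 0 = init_config m"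
      "\<And>n. step D X P (c n) (c (Suc n))"
    unfolding runs_forever_def by blast
  have "\<exists>n. d = c n" if "(step C X P)\<^sup>*\<^sup>* (init_config m) d" for d
    using that
  proof (induction rule: rtranclp_induct)
    case base
    show ?case using c(1) by metis
  next
    case (step y z)
    then obtain n where "y = c n" by blast
    then have "z = c (Suc n)" using step_deterministic[OF step.hyps(2) _ CD] c(2) by blast
    then show ?case ..
  qed
  with assms(2) show False
    unfolding halts_with_def using c(2) not_step_halted by metis
qed

lemma fb_op_compatible:
  assumes CD: "\<forall>x v w. (x, v) \<in> C \<longrightarrow> (x, w) \<in> D \<longrightarrow> v = w"
    and "(x, v) \<in> fb_op C" "(x, w) \<in> fb_op D"
  shows "v = w"
proof -
  have DC: "\<forall>x v w. (x, v) \<in> D \<longrightarrow> (x, w) \<in> C \<longrightarrow> v = w" using CD by metis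
  have hh: "k = l" if "halts_with C X P m k" "halts_with D X P m l" for X P m k l
    using halts_with_compatible[OF CD that] .
  have hr: False if "halts_with C X P m k" "runs_forever D X P m" for X P m k
    using halts_with_not_runs_forever[OF CD that(1)] that(2) by contradiction
  have rh: False if "runs_forever C X P m" "halts_with D X P m k" for X P m k
    using halts_with_not_runs_forever[OF DC that(2)] that(1) by contradiction
  show ?thesis
    using assms(2,3) unfolding fb_op_def by (auto 0 0) (erule (1) hh | erule (1) hr | erule (1) rh)+
qed

lemma I_infty_functional:
  assumes "(x, v) \<in> I_infty" "(x, w) \<in> I_infty"
  shows "v = w"
proof -
  let ?S = "{(x, v). \<forall>w. (x, w) \<in> I_infty \<longrightarrow> v = w}"
  have "v = w" if "(x, v) \<in> fb_op (I_infty \<inter> ?S)" "(x, w) \<in> I_infty" for x v w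
    using fb_op_compatible[of "I_infty \<inter> ?S" I_infty x v w] that I_infty_unfold by blast
  then have "fb_op (I_infty \<inter> ?S) \<subseteq> ?S" by blast
  then have "I_infty \<subseteq> ?S"
    unfolding I_infty_def by (intro lfp_induct[OF mono_fb_op]) auto
  with assms show ?thesis by blast
qed


section \<open>Recursive functions\<close>

text \<open>Kleene's \<open>\<mu>\<close>-recursive functions. In the minimization clause the values at all arguments
  below the least zero have to be defined.\<close>

datatype recf = Zr | Sc | Pj nat | Cmp recf "recf list" | Pr recf recf | Mn recf

inductive recf_eval :: "recf \<Rightarrow> nat list \<Rightarrow> nat \<Rightarrow> bool" where
  "recf_eval Zr xs 0"
| "recf_eval Sc [x] (Suc x)"
| "i < length xs \<Longrightarrow> recf_eval (Pj i) xs (xs ! i)"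
| "\<lbrakk>list_all2 (\<lambda>g y. recf_eval g xs y) gs ys; recf_eval f ys z\<rbrakk> \<Longrightarrow> recf_eval (Cmp f gs) xs z"
| "recf_eval f xs y \<Longrightarrow> recf_eval (Pr f g) (0 # xs) y"
| "\<lbrakk>recf_eval (Pr f g) (n # xs) y; recf_eval g (y # n # xs) z\<rbrakk>
   \<Longrightarrow> recf_eval (Pr f g) (Suc n # xs) z"
| "\<lbrakk>recf_eval f (n # xs) 0; \<And>i. i < n \<Longrightarrow> \<exists>y. recf_eval f (i # xs) (Suc y)\<rbrakk>
   \<Longrightarrow> recf_eval (Mn f) xs n"

definition recursive2 :: "(nat \<Rightarrow> nat \<Rightarrow> nat) \<Rightarrow> bool" where
  "recursive2 h \<longleftrightarrow> (\<exists>f. \<forall>a b. recf_eval f [a, b] (h a b))"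

end

theory Submission
  imports Defs
begin

text \<open>
  Suppose that at least one of two feedback computations does not freeze. Then one that does not
  freeze can be found by a program that does not freeze either. The program simulates both
  computations, and whenever they are about to make queries \<open>q\<close> and \<open>r\<close>, it asks itself recursively
  which of \<open>q\<close>, \<open>r\<close> is safe to ask, and advances the corresponding computation. If the first
  computation does not freeze, then \<open>q\<close> enters \<^term>\<open>I_infty\<close> before it, so the recursion is
  justified by induction on \<^term>\<open>I_infty\<close>; likewise for the second. A simulation that never ends
  shows only that some computation is advanced infinitely often. To learn which, the program first
  asks at every round whether advancing the first computation alone goes on forever. If it does,
  the program halts. Hence the program converges only if the first computation does not freeze, and
  diverges only if the second does not.

  If \<open>R\<close> and its complement are semi-computable with codes \<open>e\<^sub>0\<close> and \<open>e\<^sub>1\<close>, exactly one of \<open>e\<^sub>0\<close> and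
  \<open>e\<^sub>1\<close> converges at \<open>m\<close>. Asking a safe one whether it converges decides whether \<open>m \<in> R\<close>.
\<close>

section \<open>Primitive recursive functions\<close>

text \<open>Running the two computations in parallel, step by step, is impossible: a single step of
  the wrong one may already freeze, and freezing cannot be observed. The two kinds of self-query are
  safe for different reasons. The recursive one concerns two pending queries of which only one need
  be known to lie earlier in \<open>I_infty\<close>, so the induction has to allow an arbitrary
  opponent and both orders of the pair. The one about advancing the first computation alone concerns
  the same pair and is not covered by the induction; it is analysed directly, which works because
  the restricted run makes the same choices as the full one up to the moment when the second
  computation has to move. Self-reference comes from carrying the program's own index in the state
  and handing it on with each self-query. The race and the decision procedure have one shape, a loop
  that alternates one query with a primitive recursive update of a single number. Hence
  \<open>prim_rec\<close>, which yields both loop programs for the machines and \<open>recf\<close>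
  terms for the recursive function.\<close>

inductive prim_rec :: "nat \<Rightarrow> (nat list \<Rightarrow> nat) \<Rightarrow> bool" where
  prim_rec_zero: "prim_rec k (\<lambda>xs. 0)"
| prim_rec_Suc0: "prim_rec 1 (\<lambda>xs. Suc (xs ! 0))"
| prim_rec_proj: "i < k \<Longrightarrow> prim_rec k (\<lambda>xs. xs ! i)"
| prim_rec_comp: "\<lbrakk>prim_rec (length gs) f; \<forall>g\<in>set gs. prim_rec k g\<rbrakk> \<Longrightarrow> prim_rec k (\<lambda>xs. f (map (\<lambda>g. g xs) gs))"
| prim_rec_rec: "\<lbrakk>prim_rec k f; prim_rec (Suc (Suc k)) g\<rbrakk> \<Longrightarrow>
    prim_rec (Suc k) (\<lambda>xs. rec_nat (f (tl xs)) (\<lambda>n y. g (y # n # tl xs)) (hd xs))"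
| prim_rec_cong: "\<lbrakk>prim_rec k f; \<And>xs. length xs = k \<Longrightarrow> f xs = g xs\<rbrakk> \<Longrightarrow> prim_rec k g"

lemma prim_rec_recf: "prim_rec k f \<Longrightarrow> \<exists>r. \<forall>xs. length xs = k \<longrightarrow> recf_eval r xs (f xs)"
proof (induction rule: prim_rec.induct)
  case (prim_rec_zero k)
  then show ?case by (blast intro: recf_eval.intros)
next
  case prim_rec_Suc0
  have "recf_eval Sc xs (Suc (xs ! 0))" if "length xs = 1" for xs
    using that by (cases xs) (auto intro: recf_eval.intros)
  then show ?case by blast
next
  case (prim_rec_proj i k)
  then show ?case by (blast intro: recf_eval.intros)
next
  case (prim_rec_comp gs f k)
  then obtain r where r: "\<forall>xs. length xs = length gs \<longrightarrow> recf_eval r xs (f xs)" by blast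
  from prim_rec_comp(3) have "\<forall>g\<in>set gs. \<exists>r. \<forall>xs. length xs = k \<longrightarrow> recf_eval r xs (g xs)" by blast
  then obtain R where R: "\<forall>g\<in>set gs. \<forall>xs. length xs = k \<longrightarrow> recf_eval (R g) xs (g xs)" by metis
  have "recf_eval (Cmp r (map R gs)) xs (f (map (\<lambda>g. g xs) gs))" if "length xs = k" for xs
  proof (rule recf_eval.intros(4))
    show "list_all2 (\<lambda>g y. recf_eval g xs y) (map R gs) (map (\<lambda>g. g xs) gs)"
      using R that by (simp add: list_all2_conv_all_nth)
    show "recf_eval r (map (\<lambda>g. g xs) gs) (f (map (\<lambda>g. g xs) gs))" using r by simp
  qed
  then show ?case by blast
next
  case (prim_rec_rec k f g)
  then obtain r s where r: "\<forall>xs. length xs = k \<longrightarrow> recf_eval r xs (f xs)"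
    and s: "\<forall>xs. length xs = Suc (Suc k) \<longrightarrow> recf_eval s xs (g xs)" by blast
  have "recf_eval (Pr r s) (n # xs) (rec_nat (f xs) (\<lambda>n y. g (y # n # xs)) n)"
    if "length xs = k" for n xs
  proof (induction n)
    case 0
    then show ?case using r that by (auto intro: recf_eval.intros)
  next
    case (Suc n)
    then show ?case using s that by (auto intro: recf_eval.intros)
  qed
  then have "\<forall>xs. length xs = Suc k \<longrightarrow>
      recf_eval (Pr r s) xs (rec_nat (f (tl xs)) (\<lambda>n y. g (y # n # tl xs)) (hd xs))"
    by (auto simp: length_Suc_conv)
  then show ?case by blast
next
  case (prim_rec_cong k f g)
  then show ?case by auto
qed

named_theorems prim_rec_intros
declare prim_rec_zero [prim_rec_intros]

lemma prim_rec_comp1: "prim_rec 1 f \<Longrightarrow> prim_rec k a \<Longrightarrow> prim_rec k (\<lambda>xs. f [a xs])"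
  using prim_rec_comp[of "[a]" f k] by simp

lemma prim_rec_comp2: "prim_rec 2 f \<Longrightarrow> prim_rec k a \<Longrightarrow> prim_rec k b \<Longrightarrow> prim_rec k (\<lambda>xs. f [a xs, b xs])"
  using prim_rec_comp[of "[a, b]" f k] by (simp add: numeral_2_eq_2)

lemma prim_rec_proj_numeral [prim_rec_intros]:
  "prim_rec (Suc k) (\<lambda>xs. xs ! 0)"
  "prim_rec (Suc (Suc k)) (\<lambda>xs. xs ! 1)"
  "prim_rec (Suc (Suc k)) (\<lambda>xs. xs ! Suc 0)"
  "prim_rec 1 (\<lambda>xs. xs ! 0)"
  "prim_rec 2 (\<lambda>xs. xs ! 0)" "prim_rec 2 (\<lambda>xs. xs ! 1)" "prim_rec 2 (\<lambda>xs. xs ! Suc 0)"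
  "prim_rec 3 (\<lambda>xs. xs ! 0)" "prim_rec 3 (\<lambda>xs. xs ! 1)" "prim_rec 3 (\<lambda>xs. xs ! Suc 0)" "prim_rec 3 (\<lambda>xs. xs ! 2)"
  by (intro prim_rec_proj; simp)+

lemma prim_rec_Suc [prim_rec_intros]: "prim_rec k a \<Longrightarrow> prim_rec k (\<lambda>xs. Suc (a xs))"
  using prim_rec_comp1[OF prim_rec_Suc0] by simp

lemma prim_rec_const [prim_rec_intros]: "prim_rec k (\<lambda>xs. c)"
  by (induction c) (auto intro: prim_rec_intros)

lemma prim_rec_rec1:
  assumes g: "prim_rec 2 (\<lambda>xs. g (xs ! 0) (xs ! 1))"
    and f: "f 0 = c" "\<And>n. f (Suc n) = g (f n) n" and a: "prim_rec k a"
  shows "prim_rec k (\<lambda>xs. f (a xs))"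
proof -
  have "prim_rec 1 (\<lambda>xs. f (hd xs))"
  proof (rule prim_rec_cong)
    show "prim_rec 1 (\<lambda>xs. rec_nat c (\<lambda>n y. g ((y # n # tl xs) ! 0) ((y # n # tl xs) ! 1)) (hd xs))"
      unfolding One_nat_def
      by (rule prim_rec_rec[where f = "\<lambda>_. c" and k = 0, OF prim_rec_const])
        (use g in \<open>simp add: numeral_2_eq_2\<close>)
    fix xs :: "nat list"
    have "rec_nat c (\<lambda>n y. g y n) n = f n" for n by (induction n) (simp_all add: f)
    then show "rec_nat c (\<lambda>n y. g ((y # n # tl xs) ! 0) ((y # n # tl xs) ! 1)) (hd xs) = f (hd xs)"
      by simp
  qed
  from prim_rec_comp1[OF this a] show ?thesis by simp
qed

lemma prim_rec_rec2:
  assumes h: "prim_rec 1 (\<lambda>xs. h (xs ! 0))" and g: "prim_rec 3 (\<lambda>xs. g (xs ! 0) (xs ! 1) (xs ! 2))"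
    and f: "\<And>x. f 0 x = h x" "\<And>n x. f (Suc n) x = g (f n x) n x" and a: "prim_rec k a" "prim_rec k b"
  shows "prim_rec k (\<lambda>xs. f (a xs) (b xs))"
proof -
  have "prim_rec 2 (\<lambda>xs. f (xs ! 0) (xs ! 1))"
  proof (rule prim_rec_cong)
    show "prim_rec 2 (\<lambda>xs. rec_nat (h (tl xs ! 0)) (\<lambda>n y. g ((y # n # tl xs) ! 0) ((y # n # tl xs) ! 1)
        ((y # n # tl xs) ! 2)) (hd xs))"
      unfolding numeral_2_eq_2
      by (rule prim_rec_rec[where k = 1 and f = "\<lambda>xs. h (xs ! 0)", unfolded One_nat_def, OF h[unfolded One_nat_def]])
        (use g in \<open>simp add: numeral_2_eq_2 numeral_3_eq_3\<close>)
    fix xs :: "nat list"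
    assume xs: "length xs = 2"
    have "rec_nat (h x) (\<lambda>n y. g y n x) n = f n x" for n x by (induction n) (simp_all add: f)
    then show "rec_nat (h (tl xs ! 0)) (\<lambda>n y. g ((y # n # tl xs) ! 0) ((y # n # tl xs) ! 1)
        ((y # n # tl xs) ! 2)) (hd xs) = f (xs ! 0) (xs ! 1)"
      using xs by (auto simp: numeral_2_eq_2 length_Suc_conv)
  qed
  from prim_rec_comp2[OF this a] show ?thesis by simp
qed

lemma prim_rec_add [prim_rec_intros]: "prim_rec k a \<Longrightarrow> prim_rec k b \<Longrightarrow> prim_rec k (\<lambda>xs. a xs + b xs)"
  by (rule prim_rec_rec2[where f = "(+)" and h = "\<lambda>x. x" and g = "\<lambda>y n x. Suc y"])
    (auto intro: prim_rec_intros)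

lemma prim_rec_mult [prim_rec_intros]: "prim_rec k a \<Longrightarrow> prim_rec k b \<Longrightarrow> prim_rec k (\<lambda>xs. a xs * b xs)"
  by (rule prim_rec_rec2[where f = "(*)" and h = "\<lambda>x. 0" and g = "\<lambda>y n x. x + y"])
    (auto intro: prim_rec_intros)

lemma prim_rec_pred: "prim_rec k a \<Longrightarrow> prim_rec k (\<lambda>xs. a xs - 1)"
  by (rule prim_rec_rec1[where f = "\<lambda>n. n - 1" and c = 0 and g = "\<lambda>y n. n"])
    (auto intro: prim_rec_intros)

lemma prim_rec_diff [prim_rec_intros]:
  assumes "prim_rec k a" "prim_rec k b"
  shows "prim_rec k (\<lambda>xs. a xs - b xs)"
  by (rule prim_rec_rec2[where f = "\<lambda>b a. a - b" and h = "\<lambda>x. x" and g = "\<lambda>y n x. y - 1"])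
    (auto intro: prim_rec_intros prim_rec_pred prim_rec_pred[unfolded One_nat_def] assms)

lemma prim_rec_if_zero:
  assumes "prim_rec k c" "prim_rec k a" "prim_rec k b"
  shows "prim_rec k (\<lambda>xs. if c xs = 0 then a xs else b xs)"
proof -
  have "prim_rec k (\<lambda>xs. (1 - c xs) * a xs + (1 - (1 - c xs)) * b xs)"
    by (intro prim_rec_intros assms)
  then show ?thesis by (rule prim_rec_cong) simp
qed

lemma prim_rec_if_eq [prim_rec_intros]:
  assumes "prim_rec k c" "prim_rec k d" "prim_rec k a" "prim_rec k b"
  shows "prim_rec k (\<lambda>xs. if c xs = d xs then a xs else b xs)"
proof -
  have "prim_rec k (\<lambda>xs. if (c xs - d xs) + (d xs - c xs) = 0 then a xs else b xs)"
    by (intro prim_rec_intros prim_rec_if_zero assms)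
  then show ?thesis by (rule prim_rec_cong) auto
qed

text \<open>The recursion is on the dividend: the remainder counts up and wraps at \<open>x\<close>.
  For \<open>x = 0\<close> it never wraps, which agrees with \<open>n mod 0 = n\<close>.\<close>

lemma prim_rec_mod [prim_rec_intros]: "prim_rec k a \<Longrightarrow> prim_rec k b \<Longrightarrow> prim_rec k (\<lambda>xs. a xs mod b xs)"
  by (rule prim_rec_rec2[where f = "(mod)" and h = "\<lambda>x. 0"
        and g = "\<lambda>y n x. if Suc y = x then 0 else Suc y"])
    (auto intro!: prim_rec_intros simp: mod_Suc)

lemma prim_rec_div [prim_rec_intros]: "prim_rec k a \<Longrightarrow> prim_rec k b \<Longrightarrow> prim_rec k (\<lambda>xs. a xs div b xs)"
  by (rule prim_rec_rec2[where f = "(div)" and h = "\<lambda>x. 0"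
        and g = "\<lambda>y n x. if Suc n mod x = 0 then Suc y else y"])
    (auto intro!: prim_rec_intros simp: div_Suc)

lemma prim_rec_if_odd [prim_rec_intros]:
  assumes "prim_rec k c" "prim_rec k a" "prim_rec k b"
  shows "prim_rec k (\<lambda>xs. if odd (c xs) then a xs else b xs)"
proof -
  have "prim_rec k (\<lambda>xs. if c xs mod 2 = 1 then a xs else b xs)"
    by (intro prim_rec_intros assms)
  then show ?thesis by (rule prim_rec_cong) (simp add: odd_iff_mod_2_eq_one)
qed

lemma prim_rec_power [prim_rec_intros]: "prim_rec k a \<Longrightarrow> prim_rec k (\<lambda>xs. 2 ^ a xs)"
  by (rule prim_rec_rec1[where f = "\<lambda>n. 2 ^ n" and c = 1 and g = "\<lambda>y n. y + y"])
    (auto intro!: prim_rec_intros)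

lemma prim_rec_iterate:
  assumes "prim_rec 1 (\<lambda>xs. F (xs ! 0))" "prim_rec k n" "prim_rec k a"
  shows "prim_rec k (\<lambda>xs. (F ^^ n xs) (a xs))"
proof (rule prim_rec_rec2[where f = "\<lambda>n. F ^^ n" and h = "\<lambda>x. x" and g = "\<lambda>y n x. F y"])
  show "prim_rec 3 (\<lambda>xs. F (xs ! 0))" using prim_rec_comp1[OF assms(1), of 3 "\<lambda>xs. xs ! 0"]
    by (simp add: prim_rec_intros)
qed (auto intro: prim_rec_intros assms)

lemma prim_rec_triangle: "prim_rec k a \<Longrightarrow> prim_rec k (\<lambda>xs. triangle (a xs))"
  by (rule prim_rec_rec1[where f = triangle and c = 0 and g = "\<lambda>y n. y + Suc n"])
    (auto intro!: prim_rec_intros)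

lemma prim_rec_prod_encode [prim_rec_intros]:
  "prim_rec k a \<Longrightarrow> prim_rec k b \<Longrightarrow> prim_rec k (\<lambda>xs. prod_encode (a xs, b xs))"
  unfolding prod_encode_def by (simp add: prim_rec_intros prim_rec_triangle)

section \<open>Inverting the pairing function by primitive recursion\<close>

definition pfst :: "nat \<Rightarrow> nat" where "pfst n = fst (prod_decode n)"
definition psnd :: "nat \<Rightarrow> nat" where "psnd n = snd (prod_decode n)"

lemma pfst_encode [simp]: "pfst (prod_encode (a, b)) = a" by (simp add: pfst_def)
lemma psnd_encode [simp]: "psnd (prod_encode (a, b)) = b" by (simp add: psnd_def)
lemma pfst_psnd_0 [simp]: "pfst 0 = 0" "psnd 0 = 0"
  using pfst_encode[of 0 0] psnd_encode[of 0 0] by (simp_all add: prod_encode_def)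
lemma encode_pfst_psnd: "prod_encode (pfst n, psnd n) = n" by (simp add: pfst_def psnd_def)

text \<open>\<open>prod_encode (a, b)\<close> is \<open>triangle (a + b) + a\<close>, so the sum of
  the components is the index of the diagonal on which the number lies. Once that index is known,
  both components follow by subtraction.\<close>

lemma triangle_diagonal:
  "triangle (pfst n + psnd n) \<le> n" "n < triangle (Suc (pfst n + psnd n))"
proof -
  have "n = triangle (pfst n + psnd n) + pfst n"
    using encode_pfst_psnd[of n] by (simp add: prod_encode_def)
  then show "triangle (pfst n + psnd n) \<le> n" "n < triangle (Suc (pfst n + psnd n))" by simp_all
qed

lemma mono_triangle: "a \<le> b \<Longrightarrow> triangle a \<le> triangle b"
  by (induction b) (auto simp: le_Suc_eq)

lemma diagonal_unique:
  assumes "triangle s \<le> n" "n < triangle (Suc s)" "triangle t \<le> n" "n < triangle (Suc t)"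
  shows "s = t"
  by (rule ccontr) (use assms mono_triangle[of "Suc s" t] mono_triangle[of "Suc t" s] in linarith)

text \<open>This makes the diagonal index computable by recursion instead of search: it grows
  exactly when the next number is triangular.\<close>

lemma diagonal_Suc:
  "pfst (Suc n) + psnd (Suc n) =
    (if triangle (Suc (pfst n + psnd n)) = Suc n then Suc (pfst n + psnd n) else pfst n + psnd n)"
  by (rule diagonal_unique[of _ "Suc n"])
    (use triangle_diagonal[of n] triangle_diagonal[of "Suc n"] in auto)

lemma prim_rec_diagonal: "prim_rec k a \<Longrightarrow> prim_rec k (\<lambda>xs. pfst (a xs) + psnd (a xs))"
  by (rule prim_rec_rec1[where f = "\<lambda>n. pfst n + psnd n" and c = 0
        and g = "\<lambda>y n. if triangle (Suc y) = Suc n then Suc y else y"])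
    (auto intro!: prim_rec_intros prim_rec_triangle simp: diagonal_Suc simp del: triangle_Suc)

lemma prim_rec_pfst [prim_rec_intros]:
  assumes "prim_rec k a"
  shows "prim_rec k (\<lambda>xs. pfst (a xs))"
proof -
  have "prim_rec k (\<lambda>xs. a xs - triangle (pfst (a xs) + psnd (a xs)))"
    by (intro prim_rec_intros prim_rec_triangle prim_rec_diagonal assms)
  moreover have "n - triangle (pfst n + psnd n) = pfst n" for n
    using encode_pfst_psnd[of n] by (simp add: prod_encode_def)
  ultimately show ?thesis by simp
qed

lemma prim_rec_psnd [prim_rec_intros]:
  assumes "prim_rec k a"
  shows "prim_rec k (\<lambda>xs. psnd (a xs))"
proof -
  have "prim_rec k (\<lambda>xs. (pfst (a xs) + psnd (a xs)) - pfst (a xs))"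
    by (intro prim_rec_diff prim_rec_diagonal prim_rec_pfst assms)
  then show ?thesis by simp
qed

lemma prim_rec_list_encode_append:
  "prim_rec k (\<lambda>xs. list_encode (T xs)) \<Longrightarrow> prim_rec k (\<lambda>xs. list_encode (cs @ T xs))"
  by (induction cs) (auto intro!: prim_rec_intros)

section \<open>Code fragments inside a program\<close>

definition code_at :: "program \<Rightarrow> nat \<Rightarrow> instr list \<Rightarrow> bool" where
  "code_at P s is \<longleftrightarrow> s + length is \<le> length P \<and> (\<forall>i<length is. P ! (s + i) = is ! i)"

lemma code_at_whole: "code_at P 0 P"
  by (simp add: code_at_def)

lemma code_at_append:
  "code_at P s (is @ js) \<longleftrightarrow> code_at P s is \<and> code_at P (s + length is) js"
proof
  assume *: "code_at P s (is @ js)"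
  then have "P ! (s + length is + i) = js ! i" if "i < length js" for i
    using that unfolding code_at_def
    by (auto simp: nth_append algebra_simps dest: spec[of _ "length is + i"])
  moreover have "P ! (s + i) = is ! i" if "i < length is" for i
    using * that unfolding code_at_def by (auto simp: nth_append dest: spec[of _ i])
  ultimately show "code_at P s is \<and> code_at P (s + length is) js"
    using * by (auto simp: code_at_def)
next
  assume *: "code_at P s is \<and> code_at P (s + length is) js"
  have "P ! (s + i) = (is @ js) ! i" if "i < length is + length js" for i
  proof (cases "i < length is")
    case False
    then have "P ! (s + length is + (i - length is)) = js ! (i - length is)"
      using * that unfolding code_at_def by (metis add_diff_inverse_nat nat_add_left_cancel_less)
    then show ?thesis using False by (simp add: nth_append)
  qed (use * in \<open>auto simp: code_at_def nth_append\<close>)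
  then show "code_at P s (is @ js)"
    using * by (auto simp: code_at_def)
qed

lemma code_at_Cons: "code_at P s (i # is) \<longleftrightarrow> s < length P \<and> P ! s = i \<and> code_at P (Suc s) is"
proof -
  have "code_at P s [i] \<longleftrightarrow> s < length P \<and> P ! s = i" by (auto simp: code_at_def)
  then show ?thesis using code_at_append[of P s "[i]" "is"] by simp
qed

lemma step_actI:
  assumes "s < length P" "P ! s = Act t a\<^sub>0 a\<^sub>1"
    "(if scanned (ts t) then a\<^sub>1 else a\<^sub>0) = (w, d, q)"
  shows "step C X P (s, ts) (q, ts(t := move_head d (write_cell w (ts t))))"
  by (rule step_act) (use assms in auto)

section \<open>Loop programs\<close>

fun counter :: "nat \<Rightarrow> tape \<Rightarrow> bool" where
  "counter n (ls, rs) \<longleftrightarrow> True \<notin> set ls \<and> (\<exists>j. rs = replicate n True @ replicate j False)"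

lemma counter_scanned: "counter n tp \<Longrightarrow> scanned tp \<longleftrightarrow> n \<noteq> 0"
proof -
  have "hd_blank (replicate n True @ replicate j False) \<longleftrightarrow> n \<noteq> 0" for j
    by (cases n; cases j) (auto simp: hd_blank_def)
  then show "counter n tp \<Longrightarrow> scanned tp \<longleftrightarrow> n \<noteq> 0" by (cases tp) auto
qed

lemma counter_ones: "counter n tp \<Longrightarrow> ones tp = n"
proof (cases tp)
  case (Pair ls rs)
  assume "counter n tp"
  moreover have "count_list (replicate n True @ replicate j False) True = n" for j
    by (induction n) (auto simp: count_list_0_iff)
  ultimately show ?thesis using Pair by (auto simp: count_list_0_iff)
qed

lemma counter_rewrite: "counter n tp \<Longrightarrow> counter n (write_cell (scanned tp) tp)"
proof (cases tp)
  case (Pair ls rs)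
  assume c: "counter n tp"
  then obtain j where "rs = replicate n True @ replicate j False" using Pair by auto
  then show ?thesis using c Pair
    by (cases n; cases j) (auto simp: hd_blank_def intro: exI[of _ "1::nat"] exI[of _ "Suc 0"])
qed

lemma counter_inc:
  assumes "counter n tp"
  shows "counter (Suc n) (write_cell True (move_head Lft (write_cell (scanned tp) tp)))"
proof (cases tp)
  case (Pair ls rs)
  then obtain ls' rs' where *: "write_cell (scanned tp) tp = (ls', rs')" by simp
  then have "counter n (ls', rs')" using counter_rewrite[OF assms] by simp
  then show ?thesis unfolding * by (cases ls') auto
qed

lemma counter_dec:
  assumes "counter n tp" "n \<noteq> 0"
  shows "counter (n - 1) (move_head Rgt (write_cell False tp))"
  using assms by (cases tp; cases n) (auto simp: hd_blank_def)

datatype com = Skip | Inc nat | Seq com com | Loop nat com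

fun sem :: "com \<Rightarrow> (nat \<Rightarrow> nat) \<Rightarrow> nat \<Rightarrow> nat" where
  "sem Skip v = v"
| "sem (Inc t) v = v(t := Suc (v t))"
| "sem (Seq c d) v = sem d (sem c v)"
| "sem (Loop t c) v = ((\<lambda>v. sem c (v(t := v t - 1))) ^^ v t) v"

text \<open>The compiled loop runs until register \<open>t\<close> is empty, whereas
  \<open>sem\<close> fixes the number of rounds at the start. The two agree when the body preserves
  \<open>t\<close>.\<close>

fun wf_com :: "com \<Rightarrow> bool" where
  "wf_com Skip \<longleftrightarrow> True"
| "wf_com (Inc t) \<longleftrightarrow> True"
| "wf_com (Seq c d) \<longleftrightarrow> wf_com c \<and> wf_com d"
| "wf_com (Loop t c) \<longleftrightarrow> wf_com c \<and> (\<forall>v. sem c v t = v t)"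

fun com_length :: "com \<Rightarrow> nat" where
  "com_length Skip = 0"
| "com_length (Inc t) = 2"
| "com_length (Seq c d) = com_length c + com_length d"
| "com_length (Loop t c) = com_length c + 2"

fun compile :: "com \<Rightarrow> nat \<Rightarrow> instr list" where
  "compile Skip s = []"
| "compile (Inc t) s = [Act t (False, Lft, Suc s) (True, Lft, Suc s),
    Act t (True, Stay, s + 2) (True, Stay, s + 2)]"
| "compile (Seq c d) s = compile c s @ compile d (s + com_length c)"
| "compile (Loop t c) s = [Act t (False, Stay, s + com_length c + 2) (False, Rgt, Suc s)]
    @ compile c (Suc s) @ [Act t (False, Stay, s) (True, Stay, s)]"

lemma length_compile [simp]: "length (compile c s) = com_length c"
  by (induction c arbitrary: s) auto

lemma counters_upd:
  "\<forall>t. counter (v t) (ts t) \<Longrightarrow> counter n tp \<Longrightarrow> \<forall>u. counter ((v(t := n)) u) ((ts(t := tp)) u)"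
  by simp

lemma move_head_Stay [simp]: "move_head Stay tp = tp"
  by (cases tp) simp

lemma step_test:
  assumes "s < length P" "P ! s = Act t (False, Stay, q\<^sub>0) (True, Stay, q\<^sub>1)"
    and "\<forall>t. counter (v t) (ts t)"
  shows "\<exists>ts'. step C X P (s, ts) (if v t = 0 then q\<^sub>0 else q\<^sub>1, ts') \<and> (\<forall>t. counter (v t) (ts' t))"
proof -
  have sc: "scanned (ts t) \<longleftrightarrow> v t \<noteq> 0" using counter_scanned assms(3) by blast
  have "step C X P (s, ts) (if v t = 0 then q\<^sub>0 else q\<^sub>1,
      ts(t := move_head Stay (write_cell (scanned (ts t)) (ts t))))"
    by (rule step_actI) (use assms sc in auto)
  moreover have "\<forall>u. counter (v u) ((ts(t := write_cell (scanned (ts t)) (ts t))) u)"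
    using counters_upd[OF assms(3), of "v t" _ t] counter_rewrite assms(3) by auto
  ultimately show ?thesis by auto
qed

text \<open>Compiled code contains neither \<open>Oracle\<close> nor \<open>Query\<close>, so it
  runs in the same way for every \<open>C\<close> and \<open>X\<close> and cannot freeze.\<close>

lemma compile_correct:
  assumes "code_at P s (compile c s)" "wf_com c" "\<forall>t. counter (v t) (ts t)"
  shows "\<exists>ts'. (step C X P)\<^sup>*\<^sup>* (s, ts) (s + com_length c, ts') \<and> (\<forall>t. counter (sem c v t) (ts' t))"
  using assms
proof (induction c arbitrary: s v ts)
  case Skip
  then show ?case by auto
next
  case (Inc t)
  have p: "s < length P" "P ! s = Act t (False, Lft, Suc s) (True, Lft, Suc s)"
    "Suc s < length P" "P ! Suc s = Act t (True, Stay, s + 2) (True, Stay, s + 2)"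
    using Inc.prems(1) by (auto simp: code_at_Cons)
  define tp where "tp = move_head Lft (write_cell (scanned (ts t)) (ts t))"
  have "step C X P (s, ts) (Suc s, ts(t := tp))"
    unfolding tp_def by (rule step_actI) (use p in auto)
  moreover have "step C X P (Suc s, ts(t := tp))
      (s + 2, (ts(t := tp))(t := move_head Stay (write_cell True ((ts(t := tp)) t))))"
    by (rule step_actI) (use p in auto)
  ultimately have "(step C X P)\<^sup>*\<^sup>* (s, ts) (s + 2, ts(t := write_cell True tp))"
    by (simp add: converse_rtranclp_into_rtranclp)
  moreover have "counter (Suc (v t)) (write_cell True tp)"
    unfolding tp_def by (rule counter_inc) (use Inc.prems(3) in simp)
  from counters_upd[OF Inc.prems(3) this, of t]
  have "\<forall>u. counter (sem (Inc t) v u) ((ts(t := write_cell True tp)) u)" unfolding sem.simps .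
  ultimately show ?case unfolding com_length.simps by blast
next
  case (Seq c d)
  have code: "code_at P s (compile c s)" "code_at P (s + com_length c) (compile d (s + com_length c))"
    using Seq.prems(1) by (auto simp: code_at_append)
  obtain ts' where "(step C X P)\<^sup>*\<^sup>* (s, ts) (s + com_length c, ts')" "\<forall>t. counter (sem c v t) (ts' t)"
    using Seq.IH(1)[OF code(1) _ Seq.prems(3)] Seq.prems(2) by auto
  moreover from Seq.IH(2)[OF code(2) _ this(2)] Seq.prems(2) obtain ts'' where
    "(step C X P)\<^sup>*\<^sup>* (s + com_length c, ts') (s + com_length c + com_length d, ts'')"
    "\<forall>t. counter (sem d (sem c v) t) (ts'' t)" by auto
  ultimately show ?case unfolding com_length.simps sem.simps add.assoc
    by (meson rtranclp_trans)
next
  case (Loop t c)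
  have p: "s < length P" "P ! s = Act t (False, Stay, s + com_length c + 2) (False, Rgt, Suc s)"
    "code_at P (Suc s) (compile c (Suc s))" "Suc s + com_length c < length P"
    "P ! (Suc s + com_length c) = Act t (False, Stay, s) (True, Stay, s)"
    using Loop.prems(1) by (auto simp: code_at_Cons code_at_append)
  have keep: "sem c v t = v t" for v using Loop.prems(2) by simp
  show ?case using Loop.prems(3)
  \<comment> \<open>The outer hypothesis covers one run of the body from arbitrary contents; the
    inner induction is on the number of rounds left.\<close>
  proof (induction "v t" arbitrary: v ts)
    case 0
    have sc: "\<not> scanned (ts t)" using counter_scanned 0 by metis
    have "counter (v t) (write_cell (scanned (ts t)) (ts t))" using 0 counter_rewrite by blast
    then have c: "\<forall>u. counter (v u) ((ts(t := write_cell False (ts t))) u)" using 0(2) sc by simp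
    have "step C X P (s, ts) (s + com_length c + 2,
        ts(t := move_head Stay (write_cell False (ts t))))"
      by (rule step_actI) (use p sc in auto)
    then have "(step C X P)\<^sup>*\<^sup>* (s, ts) (s + com_length (Loop t c), ts(t := write_cell False (ts t)))"
      by (simp add: add.assoc)
    moreover have "sem (Loop t c) v = v" using 0(1)[symmetric] by simp
    ultimately show ?case using c by auto
  next
    case (Suc n)
    define tp where "tp = move_head Rgt (write_cell False (ts t))"
    have "scanned (ts t)" using counter_scanned Suc by (metis nat.distinct(1))
    then have 1: "step C X P (s, ts) (Suc s, ts(t := tp))"
      unfolding tp_def by (intro step_actI) (use p in auto)
    have "counter (v t - 1) tp" unfolding tp_def using Suc by (intro counter_dec) auto
    from counters_upd[OF Suc(3) this] have "\<forall>u. counter ((v(t := v t - 1)) u) ((ts(t := tp)) u)" .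
    moreover have "wf_com c" using Loop.prems(2) by simp
    ultimately obtain ts1 where
      2: "(step C X P)\<^sup>*\<^sup>* (Suc s, ts(t := tp)) (Suc s + com_length c, ts1)"
      and c: "\<forall>u. counter (sem c (v(t := v t - 1)) u) (ts1 u)" using Loop.IH[OF p(3)] by blast
    from step_test[OF p(4,5) c] obtain ts2 where
      3: "step C X P (Suc s + com_length c, ts1) (s, ts2)"
      and c2: "\<forall>u. counter (sem c (v(t := v t - 1)) u) (ts2 u)"
      unfolding if_cancel by blast
    have "n = sem c (v(t := v t - 1)) t" using Suc(2) keep by simp
    from Suc(1)[OF this c2] obtain ts' where
      4: "(step C X P)\<^sup>*\<^sup>* (s, ts2) (s + com_length (Loop t c), ts')"
        "\<forall>u. counter (sem (Loop t c) (sem c (v(t := v t - 1))) u) (ts' u)" by blast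
    have "(step C X P)\<^sup>*\<^sup>* (s, ts) (s + com_length (Loop t c), ts')"
      using 1 2 3 4(1) by (meson converse_rtranclp_into_rtranclp rtranclp_trans)
    moreover have "sem (Loop t c) (sem c (v(t := v t - 1))) = sem (Loop t c) v"
      by (simp add: Suc(2)[symmetric] keep funpow_Suc_right del: funpow.simps)
    ultimately show ?case using 4(2) by auto
  qed
qed

section \<open>Primitive recursive functions by loop programs\<close>

text \<open>\<open>b\<close> is a frontier: registers below it survive, apart from the result
  register, and those from \<open>b\<close> on are scratch with arbitrary initial contents. Raising
  the frontier protects intermediate results.\<close>

definition computes :: "com \<Rightarrow> nat \<Rightarrow> nat \<Rightarrow> ((nat \<Rightarrow> nat) \<Rightarrow> nat) \<Rightarrow> bool" where
  "computes c b r F \<longleftrightarrow> wf_com c \<and> (\<forall>v. sem c v r = F v \<and> (\<forall>t<b. t \<noteq> r \<longrightarrow> sem c v t = v t))"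

lemma computesD:
  assumes "computes c b r F"
  shows "wf_com c" "sem c v r = F v" "t < b \<Longrightarrow> t \<noteq> r \<Longrightarrow> sem c v t = v t"
  using assms by (auto simp: computes_def)

abbreviation clear :: "nat \<Rightarrow> com" where "clear r \<equiv> Loop r Skip"

lemma sem_clear [simp]: "sem (clear r) v = v(r := 0)"
proof -
  have "((\<lambda>v. v(r := v r - 1)) ^^ n) v = v(r := v r - n)" for n
    by (induction n) auto
  then show ?thesis by simp
qed

declare sem.simps(4) [simp del]

text \<open>A register can be read only by counting it down. The value is therefore moved to
  \<open>r\<close> and to the scratch register \<open>b\<close> at once, and then restored from
  \<open>b\<close>.\<close>

definition copy :: "nat \<Rightarrow> nat \<Rightarrow> nat \<Rightarrow> com" where
  "copy b a r = Seq (clear r) (Seq (clear b) (Seq (Loop a (Seq (Inc r) (Inc b))) (Loop b (Inc a))))"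

lemma copy:
  assumes "a \<noteq> b" "r \<noteq> b" "a \<noteq> r"
  shows "wf_com (copy b a r)" "sem (copy b a r) v = v(b := 0, r := v a)"
proof -
  show "wf_com (copy b a r)" using assms by (simp add: copy_def)
  have 1: "((\<lambda>v. sem (Seq (Inc r) (Inc b)) (v(a := v a - 1))) ^^ n) v =
      v(a := v a - n, r := v r + n, b := v b + n)" for n v
    by (induction n) (use assms in \<open>auto simp: fun_eq_iff\<close>)
  have 2: "((\<lambda>v. sem (Inc a) (v(b := v b - 1))) ^^ n) v = v(b := v b - n, a := v a + n)" for n v
    by (induction n) (use assms in \<open>auto simp: fun_eq_iff\<close>)
  show "sem (copy b a r) v = v(b := 0, r := v a)"
    using assms unfolding copy_def sem.simps(3) sem_clear
    by (simp only: sem.simps(4) 1 2) (auto simp: fun_eq_iff)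
qed

lemma computes_copy: "a < b \<Longrightarrow> r < b \<Longrightarrow> a \<noteq> r \<Longrightarrow> computes (copy b a r) b r (\<lambda>v. v a)"
  unfolding computes_def using copy[of a b r] by auto

lemma sem_Loop_induct:
  assumes "P 0 v" "\<And>n v'. n < v t \<Longrightarrow> P n v' \<Longrightarrow> v' t = v t - n \<Longrightarrow> P (Suc n) (sem c (v'(t := v' t - 1)))"
    and "\<And>v. sem c v t = v t"
  shows "P (v t) (sem (Loop t c) v)"
proof -
  have "P n (((\<lambda>v. sem c (v(t := v t - 1))) ^^ n) v) \<and>
      ((\<lambda>v. sem c (v(t := v t - 1))) ^^ n) v t = v t - n" if "n \<le> v t" for n
    using that
  proof (induction n)
    case (Suc n)
    define w where "w = ((\<lambda>v. sem c (v(t := v t - 1))) ^^ n) v"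
    have "P n w" "w t = v t - n" 
      using Suc.IH[OF Suc_leD[OF Suc.prems]] unfolding w_def by blast+
    then have "P (Suc n) (sem c (w(t := w t - 1))) \<and> sem c (w(t := w t - 1)) t = v t - Suc n"
      using assms(2)[of n w] assms(3) Suc.prems by simp
    then show ?case by (simp only: funpow.simps comp_apply w_def)
  qed (use assms(1) in simp)
  then show ?thesis by (simp add: sem.simps(4))
qed

text \<open>The values are stored in consecutive registers, and the frontier is raised past each one
  that is finished. As the functions look only at registers below \<open>d\<close>, the values
  stored earlier do not disturb those computed later.\<close>

lemma computes_list:
  assumes "\<forall>g\<in>set gs. \<forall>b r. r < b \<longrightarrow> d \<le> r \<longrightarrow> (\<exists>c. computes c b r (G g))"
    and "\<And>g v w. g \<in> set gs \<Longrightarrow> (\<And>t. t < d \<Longrightarrow> v t = w t) \<Longrightarrow> G g v = G g w" and "d \<le> b"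
  shows "\<exists>c. wf_com c \<and> (\<forall>v. (\<forall>t<b. sem c v t = v t) \<and>
    (\<forall>i<length gs. sem c v (b + i) = G (gs ! i) v))"
  using assms
proof (induction gs arbitrary: b)
  case Nil
  show ?case by (rule exI[of _ Skip]) simp
next
  case (Cons g gs)
  have "b < Suc b" "d \<le> b" using Cons.prems(3) by simp_all
  then obtain c where c: "computes c (Suc b) b (G g)"
    using Cons.prems(1) by (meson list.set_intros(1))
  have "\<exists>c. wf_com c \<and> (\<forall>v. (\<forall>t<Suc b. sem c v t = v t) \<and>
      (\<forall>i<length gs. sem c v (Suc b + i) = G (gs ! i) v))"
  proof (rule Cons.IH)
    show "\<forall>g\<in>set gs. \<forall>b r. r < b \<longrightarrow> d \<le> r \<longrightarrow> (\<exists>c. computes c b r (G g))"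
      using Cons.prems(1) by simp
    show "G h v = G h w" if "h \<in> set gs" "\<And>t. t < d \<Longrightarrow> v t = w t" for h v w
      by (rule Cons.prems(2)) (simp_all add: that)
    show "d \<le> Suc b" using Cons.prems(3) by simp
  qed
  then obtain e where e: "wf_com e" "\<And>v t. t < Suc b \<Longrightarrow> sem e v t = v t"
    "\<And>v i. i < length gs \<Longrightarrow> sem e v (Suc b + i) = G (gs ! i) v"
    by blast
  have "G h (sem c v) = G h v" if "h \<in> set gs" for h v
    by (rule Cons.prems(2)) (use that Cons.prems(3) computesD[OF c] in auto)
  then have "sem e (sem c v) (b + i) = G ((g # gs) ! i) v" if "i < length (g # gs)" for v i
    using that e computesD(2)[OF c] by (cases i) (auto)
  then show ?case
    using e computesD[OF c] by (intro exI[of _ "Seq c e"]) auto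
qed

text \<open>The result register is kept apart from the arguments because it may be cleared before
  they are read. Composition first places the inner values from \<open>b\<close> upwards and then
  treats them as the arguments of \<open>f\<close>.\<close>

lemma prim_rec_computes:
  assumes "prim_rec k f" "length as = k" "set as \<subseteq> {..<b}" "r < b" "r \<notin> set as"
  shows "\<exists>c. computes c b r (\<lambda>v. f (map v as))"
  using assms
proof (induction arbitrary: as b r rule: prim_rec.induct)
  case (prim_rec_zero k)
  then show ?case by (intro exI[of _ "clear r"]) (auto simp: computes_def)
next
  case prim_rec_Suc0
  then have "computes (Seq (copy b (as ! 0) r) (Inc r)) b r (\<lambda>v. Suc (map v as ! 0))"
    using copy[of "as ! 0" b r] by (cases as) (auto simp: computes_def)
  then show ?case by blast
next
  case (prim_rec_proj i k)
  then have "as ! i < b" "as ! i \<noteq> r" by (metis lessThan_iff nth_mem subset_iff, metis nth_mem)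
  then show ?case using computes_copy[of "as ! i" b r] prim_rec_proj by auto
next
  case (prim_rec_comp gs f k)
  have "\<exists>c. wf_com c \<and> (\<forall>v. (\<forall>t<b. sem c v t = v t) \<and>
      (\<forall>i<length gs. sem c v (b + i) = (gs ! i) (map v as)))"
  proof (rule computes_list[where G = "\<lambda>g v. g (map v as)" and d = b])
    show "\<forall>g\<in>set gs. \<forall>b' r. r < b' \<longrightarrow> b \<le> r \<longrightarrow> (\<exists>c. computes c b' r (\<lambda>v. g (map v as)))"
    proof (intro ballI allI impI)
      fix g b' r assume "g \<in> set gs" "r < b'" "b \<le> r"
      moreover from this have "set as \<subseteq> {..<b'}" "r \<notin> set as"
        using prim_rec_comp.prems(2) by (auto simp: subset_iff)
      ultimately show "\<exists>c. computes c b' r (\<lambda>v. g (map v as))"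
        using prim_rec_comp.IH(2) prim_rec_comp.prems(1) by blast
    qed
    fix g :: "nat list \<Rightarrow> nat" and v w :: "nat \<Rightarrow> nat" assume "\<And>t. t < b \<Longrightarrow> v t = w t"
    then show "g (map v as) = g (map w as)" using prim_rec_comp.prems(2) by (intro arg_cong[of _ _ g]) auto
  qed simp
  then obtain c where c: "wf_com c" "\<And>v t. t < b \<Longrightarrow> sem c v t = v t"
    "\<And>v i. i < length gs \<Longrightarrow> sem c v (b + i) = (gs ! i) (map v as)" by blast
  have "\<exists>d. computes d (b + length gs) r (\<lambda>v. f (map v [b..<b + length gs]))"
    using prim_rec_comp.prems by (intro prim_rec_comp.IH) auto
  then obtain d where d: "computes d (b + length gs) r (\<lambda>v. f (map v [b..<b + length gs]))" ..
  have "map (sem c v) [b..<b + length gs] = map (\<lambda>g. g (map v as)) gs" for v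
    by (rule nth_equalityI) (auto simp: c)
  then have "computes (Seq c d) b r (\<lambda>v. f (map (\<lambda>g. g (map v as)) gs))"
    using c d by (auto simp: computes_def)
  then show ?case by blast
next
  case (prim_rec_rec k f g)
  then obtain n as' where as: "as = n # as'" "length as' = k" by (cases as) auto
  have n: "n < b" "n \<noteq> r" "set as' \<subseteq> {..<b}" "r \<notin> set as'" "r < b"
    using prim_rec_rec.prems as by auto
  \<comment> \<open>The registers from \<open>b\<close> on hold the accumulator, the loop counter,
    the number of rounds done and the next accumulator; scratch space begins at \<open>B\<close>.
    The next accumulator has a register of its own because \<open>g\<close> reads the old
    one.\<close>
  define B where "B = b + 4"
  have "\<exists>c. computes c B b (\<lambda>v. f (map v as'))"
    using n as unfolding B_def by (intro prim_rec_rec.IH) auto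
  then obtain c where c: "computes c B b (\<lambda>v. f (map v as'))" ..
  have "\<exists>d. computes d B (b + 3) (\<lambda>v. g (map v (b # (b + 2) # as')))"
    using n as unfolding B_def by (intro prim_rec_rec.IH) auto
  then obtain d where d: "computes d B (b + 3) (\<lambda>v. g (map v (b # (b + 2) # as')))" ..
  define body where "body = Seq d (Seq (copy B (b + 3) b) (Inc (b + 2)))"
  define e where "e = Seq c (Seq (copy B n (b + 1)) (Seq (clear (b + 2))
     (Seq (Loop (b + 1) body) (copy B b r))))"
  have cp: "wf_com (copy B (b + 3) b)" "sem (copy B (b + 3) b) v = v(B := 0, b := v (b + 3))"
    "wf_com (copy B n (b + 1))" "sem (copy B n (b + 1)) v = v(B := 0, b + 1 := v n)"
    "wf_com (copy B b r)" "sem (copy B b r) v = v(B := 0, r := v b)" for v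
    using n by (auto intro!: copy simp: B_def)
  have keep: "sem body v (b + 1) = v (b + 1)" for v
    unfolding body_def using cp computesD[OF d] by (simp add: B_def)
  have wf: "wf_com e"
    unfolding e_def using cp computesD[OF d] computesD[OF c] keep by (simp add: body_def)
  have body: "sem body v b = g (v b # v (b + 2) # map v as')"
    "sem body v (b + 2) = Suc (v (b + 2))" "t < b \<Longrightarrow> sem body v t = v t" for v t
    unfolding body_def using cp computesD[OF d] by (auto simp: B_def)
  define F where "F xs = rec_nat (f xs) (\<lambda>n y. g (y # n # xs))" for xs
  have loop: "sem (Loop (b + 1) body) v b = F xs (v (b + 1)) \<and>
      (\<forall>t<b. sem (Loop (b + 1) body) v t = v t)"
    if "v b = f xs" "v (b + 2) = 0" "map v as' = xs" for v xs
  proof -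
    have "sem (Loop (b + 1) body) v b = F xs (v (b + 1)) \<and> sem (Loop (b + 1) body) v (b + 2) = v (b + 1)
      \<and> (\<forall>t<b. sem (Loop (b + 1) body) v t = v t)"
    proof (rule sem_Loop_induct[where P = "\<lambda>n w. w b = F xs n \<and> w (b + 2) = n \<and> (\<forall>t<b. w t = v t)"])
      show "v b = F xs 0 \<and> v (b + 2) = 0 \<and> (\<forall>t<b. v t = v t)" using that by (simp add: F_def)
      fix m w assume w: "w b = F xs m \<and> w (b + 2) = m \<and> (\<forall>t<b. w t = v t)"
      then have "map (w(b + 1 := w (b + 1) - 1)) as' = xs" 
        using that n by (force simp: subset_iff)
      with w body[where v = "w(b + 1 := w (b + 1) - 1)"]
      show "sem body (w(b + 1 := w (b + 1) - 1)) b = F xs (Suc m) \<and>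
          sem body (w(b + 1 := w (b + 1) - 1)) (b + 2) = Suc m \<and>
          (\<forall>t<b. sem body (w(b + 1 := w (b + 1) - 1)) t = v t)"
        by (simp add: F_def)
    qed (rule keep)
    then show ?thesis by blast
  qed
  have "sem e v r = F (map v as') (v n) \<and> (\<forall>t<b. t \<noteq> r \<longrightarrow> sem e v t = v t)" for v
  proof -
    define w where "w = (sem c v)(B := 0, b + 1 := sem c v n, b + 2 := 0)"
    have w1: "w t = v t" if "t < b" for t
      using that computesD(3)[OF c, of t v] by (simp add: w_def B_def)
    have w2: "w b = f (map v as')" "w (b + 2) = 0" "w (b + 1) = v n"
      using computesD[OF c] n by (auto simp: w_def B_def)
    have "map w as' = map v as'" using w1 n by auto
    from loop[OF w2(1,2) this] w2(3) w1
    have "sem (Loop (b + 1) body) w b = F (map v as') (v n)"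
      "\<forall>t<b. sem (Loop (b + 1) body) w t = v t" by auto
    moreover have "sem e v = (sem (Loop (b + 1) body) w)(B := 0, r := sem (Loop (b + 1) body) w b)"
      by (simp only: e_def cp w_def sem.simps(3) sem_clear)
    ultimately show ?thesis by (simp add: B_def)
  qed
  with wf have "computes e b r (\<lambda>v. F (map v as') (v n))" by (simp add: computes_def)
  then show ?case unfolding F_def by (auto simp: as)
next
  case (prim_rec_cong k f g)
  then obtain c where "computes c b r (\<lambda>v. f (map v as))" by blast
  then show ?case using prim_rec_cong by (intro exI[of _ c]) (auto simp: computes_def)
qed

section \<open>Query machines\<close>

definition answer_code :: "answer \<Rightarrow> nat" where
  "answer_code j = (case j of Down \<Rightarrow> 0 | Up \<Rightarrow> 1)"

lemma answer_code_simps [simp]: "answer_code Down = 0" "answer_code Up = 1"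
  by (simp_all add: answer_code_def)

text \<open>An abstract machine whose whole state is the number \<open>s\<close>: \<open>H\<close>
  is its halting flag, \<open>A\<close> and \<open>B\<close> give the pending query,
  \<open>N\<close> the successor state. A query on which \<open>C\<close> is undefined leaves no
  successor, so freezing is modelled faithfully.\<close>

definition query_step :: "outcomes \<Rightarrow> oracle_set \<Rightarrow> (nat \<Rightarrow> nat) \<Rightarrow> (nat \<Rightarrow> nat) \<Rightarrow> (nat \<Rightarrow> nat) \<Rightarrow>
    (nat \<Rightarrow> nat \<Rightarrow> nat) \<Rightarrow> nat \<Rightarrow> nat \<Rightarrow> bool" where
  "query_step C X H A B N s s' \<longleftrightarrow>
     H s \<noteq> 0 \<and> (\<exists>j k. ((A s, B s, X), (j, k)) \<in> C \<and> s' = N s (answer_code j))"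

lemma infinite_chain_from_invariant:
  assumes "P x" "\<And>x. P x \<Longrightarrow> \<exists>y. R x y \<and> P y"
  shows "\<exists>c. c 0 = x \<and> (\<forall>n::nat. R (c n) (c (Suc n)) \<and> P (c n))"
proof -
  obtain c where "\<forall>n. P (c n) \<and> (n = 0 \<longrightarrow> c n = x)" "\<forall>n. R (c n) (c (Suc n))"
    using dependent_nat_choice[of "\<lambda>n y. P y \<and> (n = 0 \<longrightarrow> y = x)" "\<lambda>_ y z. R y z"] assms by blast
  then show ?thesis by (intro exI[of _ c]) auto
qed

text \<open>Each big step consists of at least one single step, so being on the way to a point of
  \<open>S\<close> is an invariant that single steps can maintain forever. With
  \<open>R\<^sup>*\<^sup>*\<close> in place of \<open>R\<^sup>+\<^sup>+\<close> the run could
  stall.\<close>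

lemma infinite_chain_tranclp:
  assumes "\<And>n x. S n x \<Longrightarrow> \<exists>y. R\<^sup>+\<^sup>+ x y \<and> S (Suc n) y" and "R\<^sup>*\<^sup>* x y" "S 0 y"
  shows "\<exists>c. c 0 = x \<and> (\<forall>n::nat. R (c n) (c (Suc n)))"
proof -
  define P where "P x \<longleftrightarrow> (\<exists>n y. R\<^sup>*\<^sup>* x y \<and> S n y)" for x
  have "\<exists>y. R x y \<and> P y" if "P x" for x
  proof -
    from that obtain n y where "R\<^sup>*\<^sup>* x y" "S n y" unfolding P_def by blast
    moreover from this(2) obtain z where "R\<^sup>+\<^sup>+ y z" "S (Suc n) z" using assms(1) by blast
    ultimately have "R\<^sup>+\<^sup>+ x z" "S (Suc n) z" by auto
    then show ?thesis unfolding P_def by (meson tranclpD)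
  qed
  moreover have "P x" unfolding P_def using assms(2,3) by blast
  ultimately show ?thesis using infinite_chain_from_invariant[of P x R] by blast
qed

text \<open>
  Register 2 holds the state of the query machine, registers 3 to 6 the halting flag, the pending
  query and its answer. The machine is a fixed table followed by \<open>n\<close> instructions that
  write the parameter \<open>n\<close> on tape 1. Control passes through these instructions twice: at the
  start, and again after the output has been computed, because the halting address depends on
  \<open>n\<close> and so cannot occur in the fixed table. The mark on tape 8 distinguishes the two passes.
\<close>

locale query_machine =
  fixes I :: "nat \<Rightarrow> nat \<Rightarrow> nat" and H A B :: "nat \<Rightarrow> nat" and N :: "nat \<Rightarrow> nat \<Rightarrow> nat"
    and out :: "nat \<Rightarrow> nat" and cI cW cN cO :: com
  assumes cI: "wf_com cI" "\<And>v. sem cI v 2 = I (v 0) (v 1)" "\<And>v. sem cI v 8 = v 8"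
    and cW: "wf_com cW" "\<And>v. sem cW v 2 = v 2" "\<And>v. sem cW v 3 = H (v 2)"
      "\<And>v. sem cW v 4 = A (v 2)" "\<And>v. sem cW v 5 = B (v 2)" "\<And>v. sem cW v 6 = 0"
      "\<And>v. sem cW v 8 = v 8"
    and cN: "wf_com cN" "\<And>v. sem cN v 2 = N (v 2) (v 6)" "\<And>v. sem cN v 8 = v 8"
    and cO: "wf_com cO" "\<And>v. sem cO v 0 = out (v 2)" "\<And>v. sem cO v 8 \<noteq> 0"
begin

definition a\<^sub>0 :: nat where "a\<^sub>0 = 2 + com_length cI"
definition a\<^sub>1 :: nat where "a\<^sub>1 = a\<^sub>0 + com_length cW"
definition a\<^sub>2 :: nat where "a\<^sub>2 = a\<^sub>1 + 4 + com_length cN"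
definition a\<^sub>3 :: nat where "a\<^sub>3 = a\<^sub>2 + 1 + com_length cO"

text \<open>\<open>a\<^sub>0\<close> is the head of the loop, \<open>a\<^sub>1\<close> the halting
  test, \<open>a\<^sub>2\<close> the jump back and \<open>a\<^sub>3\<close> the start of the writer.
  Register 6 is cleared in every round; the answer \<open>Down\<close> skips \<open>Inc 6\<close>
  and \<open>Up\<close> passes through it, so that it holds \<open>answer_code\<close> when
  \<open>cN\<close> starts.\<close>

definition table :: "instr list" where
  "table = [Act 0 (False, Stay, a\<^sub>3) (True, Stay, a\<^sub>3), Act 1 (False, Rgt, 2) (False, Rgt, 2)]
    @ compile cI 2 @ compile cW a\<^sub>0
    @ [Act 3 (False, Stay, a\<^sub>2 + 1) (True, Stay, a\<^sub>1 + 1), Query 4 5 (a\<^sub>1 + 4) (a\<^sub>1 + 2)]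
    @ compile (Inc 6) (a\<^sub>1 + 2) @ compile cN (a\<^sub>1 + 4)
    @ [Act 3 (False, Stay, a\<^sub>0) (True, Stay, a\<^sub>0)] @ compile cO (a\<^sub>2 + 1)"

definition writer :: "nat \<Rightarrow> instr list" where
  "writer n = map (\<lambda>i. Act 1 (True, Lft, Suc (a\<^sub>3 + i)) (True, Lft, Suc (a\<^sub>3 + i))) [0..<n]"

definition machine :: "nat \<Rightarrow> program" where
  "machine n = table @ writer n @ [Act 8 (False, Stay, 1) (True, Stay, Suc (a\<^sub>3 + n))]"

lemma length_table: "length table = a\<^sub>3"
  by (simp add: table_def a\<^sub>0_def a\<^sub>1_def a\<^sub>2_def a\<^sub>3_def)

lemma length_machine: "length (machine n) = Suc (a\<^sub>3 + n)"
  by (simp add: machine_def length_table writer_def)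

lemma code:
  fixes n
  defines "P \<equiv> machine n"
  shows "0 < length P" "P ! 0 = Act 0 (False, Stay, a\<^sub>3) (True, Stay, a\<^sub>3)"
    "1 < length P" "P ! 1 = Act 1 (False, Rgt, 2) (False, Rgt, 2)"
    "code_at P 2 (compile cI 2)" "code_at P a\<^sub>0 (compile cW a\<^sub>0)"
    "a\<^sub>1 < length P" "P ! a\<^sub>1 = Act 3 (False, Stay, a\<^sub>2 + 1) (True, Stay, a\<^sub>1 + 1)"
    "a\<^sub>1 + 1 < length P" "P ! (a\<^sub>1 + 1) = Query 4 5 (a\<^sub>1 + 4) (a\<^sub>1 + 2)"
    "code_at P (a\<^sub>1 + 2) (compile (Inc 6) (a\<^sub>1 + 2))" "code_at P (a\<^sub>1 + 4) (compile cN (a\<^sub>1 + 4))"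
    "a\<^sub>2 < length P" "P ! a\<^sub>2 = Act 3 (False, Stay, a\<^sub>0) (True, Stay, a\<^sub>0)"
    "code_at P (a\<^sub>2 + 1) (compile cO (a\<^sub>2 + 1))" "code_at P a\<^sub>3 (writer n)"
    "a\<^sub>3 + n < length P" "P ! (a\<^sub>3 + n) = Act 8 (False, Stay, 1) (True, Stay, Suc (a\<^sub>3 + n))"
proof -
  have *: "length (writer n) = n" by (simp add: writer_def)
  have "code_at P 0 (machine n)" unfolding P_def by (rule code_at_whole)
  then have c: "code_at P 0 table" "code_at P a\<^sub>3 (writer n)"
    "code_at P (a\<^sub>3 + n) [Act 8 (False, Stay, 1) (True, Stay, Suc (a\<^sub>3 + n))]"
    unfolding machine_def code_at_append by (simp_all add: length_table *)
  have e: "0 + length [x, y] = 2" "2 + length (compile cI 2) = a\<^sub>0"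
    "a\<^sub>0 + length (compile cW a\<^sub>0) = a\<^sub>1" "a\<^sub>1 + length [x, y] = a\<^sub>1 + 2"
    "a\<^sub>1 + 2 + length (compile (Inc 6) (a\<^sub>1 + 2)) = a\<^sub>1 + 4"
    "a\<^sub>1 + 4 + length (compile cN (a\<^sub>1 + 4)) = a\<^sub>2" "a\<^sub>2 + length [x] = a\<^sub>2 + 1" for x y :: instr
    by (simp_all add: a\<^sub>0_def a\<^sub>1_def a\<^sub>2_def)
  show "0 < length P" "P ! 0 = Act 0 (False, Stay, a\<^sub>3) (True, Stay, a\<^sub>3)"
    "1 < length P" "P ! 1 = Act 1 (False, Rgt, 2) (False, Rgt, 2)"
    "code_at P 2 (compile cI 2)" "code_at P a\<^sub>0 (compile cW a\<^sub>0)"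
    "a\<^sub>1 < length P" "P ! a\<^sub>1 = Act 3 (False, Stay, a\<^sub>2 + 1) (True, Stay, a\<^sub>1 + 1)"
    "a\<^sub>1 + 1 < length P" "P ! (a\<^sub>1 + 1) = Query 4 5 (a\<^sub>1 + 4) (a\<^sub>1 + 2)"
    "code_at P (a\<^sub>1 + 2) (compile (Inc 6) (a\<^sub>1 + 2))" "code_at P (a\<^sub>1 + 4) (compile cN (a\<^sub>1 + 4))"
    "a\<^sub>2 < length P" "P ! a\<^sub>2 = Act 3 (False, Stay, a\<^sub>0) (True, Stay, a\<^sub>0)"
    "code_at P (a\<^sub>2 + 1) (compile cO (a\<^sub>2 + 1))"
    using c(1) unfolding table_def code_at_append e code_at_Cons
    by (simp_all del: compile.simps)
  show "code_at P a\<^sub>3 (writer n)" "a\<^sub>3 + n < length P"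
    "P ! (a\<^sub>3 + n) = Act 8 (False, Stay, 1) (True, Stay, Suc (a\<^sub>3 + n))"
    using c(2,3) unfolding code_at_Cons by auto
qed

text \<open>Each instruction writes a 1 and moves left, so the head ends one cell to the left of the
  block; hence \<open>tl rs\<close>. Instruction 1 of the table moves it back. On the second pass
  tape 1 may hold anything, and it only matters that the other tapes are unchanged.\<close>

lemma writer_run:
  assumes "i \<le> n"
  shows "\<exists>ls rs. (step C X (machine n))\<^sup>*\<^sup>* (a\<^sub>3, ts) (a\<^sub>3 + i, ts(1 := (ls, rs))) \<and>
    (counter 0 (ts 1) \<longrightarrow> counter i (ls, tl rs))"
  using assms
proof (induction i)
  case 0
  obtain ls rs where "ts 1 = (ls, rs)" by (cases "ts 1")
  moreover have "ts = ts(1 := ts 1)" by simp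
  ultimately show ?case by (intro exI[of _ ls] exI[of _ rs]) (auto simp: tl_replicate)
next
  case (Suc i)
  then obtain ls rs where 1: "(step C X (machine n))\<^sup>*\<^sup>* (a\<^sub>3, ts) (a\<^sub>3 + i, ts(1 := (ls, rs)))"
    "counter 0 (ts 1) \<longrightarrow> counter i (ls, tl rs)" by (meson Suc_leD)
  have "a\<^sub>3 + i < length (machine n) \<and> machine n ! (a\<^sub>3 + i) =
      Act 1 (True, Lft, Suc (a\<^sub>3 + i)) (True, Lft, Suc (a\<^sub>3 + i))"
    using code(16)[of n] Suc.prems by (simp add: code_at_def writer_def)
  then have "step C X (machine n) (a\<^sub>3 + i, ts(1 := (ls, rs))) (Suc (a\<^sub>3 + i),
      (ts(1 := (ls, rs)))(1 := move_head Lft (write_cell True ((ts(1 := (ls, rs))) 1))))"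
    by (intro step_actI) auto
  then have "step C X (machine n) (a\<^sub>3 + i, ts(1 := (ls, rs)))
      (a\<^sub>3 + Suc i, ts(1 := (tl ls, hd_blank ls # True # tl rs)))" by simp
  with 1(1) have "(step C X (machine n))\<^sup>*\<^sup>* (a\<^sub>3, ts)
      (a\<^sub>3 + Suc i, ts(1 := (tl ls, hd_blank ls # True # tl rs)))"
    by (rule rtranclp.rtrancl_into_rtrancl)
  moreover have "counter 0 (ts 1) \<longrightarrow> counter (Suc i) (tl ls, tl (hd_blank ls # True # tl rs))"
    using 1(2) by (cases ls) auto
  ultimately show ?case by blast
qed

lemma init_run:
  "\<exists>ts v. (step C X (machine n))\<^sup>*\<^sup>* (init_config m) (a\<^sub>0, ts) \<and> (\<forall>t. counter (v t) (ts t)) \<and>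
    v 2 = I m n \<and> v 8 = 0"
proof -
  define v :: "nat \<Rightarrow> nat" where "v = (\<lambda>_. 0)(0 := m)"
  define w where "w = v(1 := n)"
  obtain ts where init: "init_config m = (0, ts)" and ts: "\<forall>t. counter (v t) (ts t)"
    unfolding init_config_def v_def by (auto intro: exI[of _ "0::nat"])
  obtain ts1 where 1: "step C X (machine n) (0, ts) (a\<^sub>3, ts1)" "\<forall>t. counter (v t) (ts1 t)"
    using step_test[OF code(1,2) ts] unfolding if_cancel by blast
  obtain ls rs where 2: "(step C X (machine n))\<^sup>*\<^sup>* (a\<^sub>3, ts1) (a\<^sub>3 + n, ts1(1 := (ls, rs)))"
    "counter n (ls, tl rs)"
    using writer_run[OF order_refl, of C X n ts1] 1(2)[rule_format, of 1]
    unfolding v_def by (auto simp del: counter.simps)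
  define ts2 where "ts2 = ts1(1 := (ls, rs))"
  have "\<not> scanned (ts2 8)" using 1(2)[rule_format, of 8] counter_scanned[of 0 "ts1 8"]
    by (simp add: ts2_def v_def)
  then have 3: "step C X (machine n) (a\<^sub>3 + n, ts2) (1, ts2(8 := move_head Stay (write_cell False (ts2 8))))"
    by (intro step_actI) (use code(17,18) in auto)
  define ts3 where "ts3 = ts2(8 := write_cell False (ts2 8))"
  have 4: "step C X (machine n) (1, ts3) (2, ts3(1 := move_head Rgt (write_cell False (ts3 1))))"
    by (rule step_actI) (use code(3,4) in auto)
  have "\<forall>t. counter (w t) ((ts3(1 := move_head Rgt (write_cell False (ts3 1)))) t)"
    using 1(2) 1(2)[rule_format, of 8] 2(2) counter_rewrite[of 0 "ts1 8"] counter_scanned[of 0 "ts1 8"]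
    by (auto simp: w_def v_def ts3_def ts2_def hd_blank_def)
  from compile_correct[OF code(5) cI(1) this] obtain ts4 where
    5: "(step C X (machine n))\<^sup>*\<^sup>* (2, ts3(1 := move_head Rgt (write_cell False (ts3 1)))) (a\<^sub>0, ts4)"
    "\<forall>t. counter (sem cI w t) (ts4 t)" unfolding a\<^sub>0_def by blast
  have "(step C X (machine n))\<^sup>*\<^sup>* (init_config m) (a\<^sub>0, ts4)"
    unfolding init using 1(1) 2(1) 3 4 5(1)
    unfolding ts2_def[symmetric] ts3_def[symmetric] move_head_Stay
    by (meson converse_rtranclp_into_rtranclp rtranclp_trans)
  moreover have "sem cI w 2 = I m n" "sem cI w 8 = 0" by (simp_all add: cI w_def v_def)
  ultimately show ?thesis using 5(2) by blast
qed

lemma test_run: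
  assumes "\<forall>t. counter (v t) (ts t)"
  shows "\<exists>ts'. (step C X (machine n))\<^sup>+\<^sup>+ (a\<^sub>0, ts) (if H (v 2) = 0 then a\<^sub>2 + 1 else a\<^sub>1 + 1, ts') \<and>
    (\<forall>t. counter (sem cW v t) (ts' t))"
proof -
  from compile_correct[OF code(6) cW(1) assms] obtain ts1 where
    "(step C X (machine n))\<^sup>*\<^sup>* (a\<^sub>0, ts) (a\<^sub>1, ts1)" "\<forall>t. counter (sem cW v t) (ts1 t)"
    unfolding a\<^sub>1_def by blast
  moreover from step_test[OF code(7,8) this(2)] obtain ts2 where
    "step C X (machine n) (a\<^sub>1, ts1) (if H (v 2) = 0 then a\<^sub>2 + 1 else a\<^sub>1 + 1, ts2)"
    "\<forall>t. counter (sem cW v t) (ts2 t)" unfolding cW by blast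
  ultimately show ?thesis by (meson rtranclp_into_tranclp1)
qed

lemma loop_run:
  assumes v: "\<forall>t. counter (v t) (ts t)" "v 8 = 0" and q: "query_step C X H A B N (v 2) s'"
  shows "\<exists>ts' v'. (step C X (machine n))\<^sup>+\<^sup>+ (a\<^sub>0, ts) (a\<^sub>0, ts') \<and> (\<forall>t. counter (v' t) (ts' t)) \<and>
    v' 2 = s' \<and> v' 8 = 0"
proof -
  from q obtain j k where H: "H (v 2) \<noteq> 0" and
    j: "((A (v 2), B (v 2), X), (j, k)) \<in> C" "s' = N (v 2) (answer_code j)"
    unfolding query_step_def by blast
  obtain ts1 where
    1: "(step C X (machine n))\<^sup>+\<^sup>+ (a\<^sub>0, ts) (a\<^sub>1 + 1, ts1)" "\<forall>t. counter (sem cW v t) (ts1 t)"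
    using test_run[OF v(1), of C X n] unfolding if_not_P[OF H] by blast
  have "ones (ts1 4) = A (v 2)" "ones (ts1 5) = B (v 2)"
    using counter_ones 1(2) cW by metis+
  then have 2: "step C X (machine n) (a\<^sub>1 + 1, ts1) (case j of Down \<Rightarrow> a\<^sub>1 + 4 | Up \<Rightarrow> a\<^sub>1 + 2, ts1)"
    by (intro step_query[OF code(9,10)]) (use j in simp)
  have "\<exists>ts2 w. (step C X (machine n))\<^sup>*\<^sup>* (case j of Down \<Rightarrow> a\<^sub>1 + 4 | Up \<Rightarrow> a\<^sub>1 + 2, ts1) (a\<^sub>1 + 4, ts2) \<and>
      (\<forall>t. counter (w t) (ts2 t)) \<and> w 2 = v 2 \<and> w 6 = answer_code j \<and> w 8 = 0"
  proof (cases j)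
    case Down
    then show ?thesis using 1(2) cW v(2) by (intro exI[of _ ts1] exI[of _ "sem cW v"]) auto
  next
    case Up
    have "wf_com (Inc 6)" by simp
    have "a\<^sub>1 + 2 + com_length (Inc 6) = a\<^sub>1 + 4" by simp
    with compile_correct[OF code(11) \<open>wf_com (Inc 6)\<close> 1(2), of C X] obtain ts2 where
      "(step C X (machine n))\<^sup>*\<^sup>* (a\<^sub>1 + 2, ts1) (a\<^sub>1 + 4, ts2)"
      "\<forall>t. counter (sem (Inc 6) (sem cW v) t) (ts2 t)" by metis
    moreover have "sem (Inc 6) (sem cW v) 2 = v 2" "sem (Inc 6) (sem cW v) 6 = answer_code j"
      "sem (Inc 6) (sem cW v) 8 = 0" using Up cW v(2) by simp_all
    ultimately show ?thesis unfolding Up answer.case by blast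
  qed
  then obtain ts2 w where
    3: "(step C X (machine n))\<^sup>*\<^sup>* (case j of Down \<Rightarrow> a\<^sub>1 + 4 | Up \<Rightarrow> a\<^sub>1 + 2, ts1) (a\<^sub>1 + 4, ts2)"
      "\<forall>t. counter (w t) (ts2 t)" and w: "w 2 = v 2" "w 6 = answer_code j" "w 8 = 0" by blast
  from compile_correct[OF code(12) cN(1) 3(2)] obtain ts3 where
    4: "(step C X (machine n))\<^sup>*\<^sup>* (a\<^sub>1 + 4, ts2) (a\<^sub>2, ts3)" "\<forall>t. counter (sem cN w t) (ts3 t)"
    unfolding a\<^sub>2_def by blast
  from step_test[OF code(13,14) 4(2)] obtain ts4 where
    5: "step C X (machine n) (a\<^sub>2, ts3) (a\<^sub>0, ts4)" "\<forall>t. counter (sem cN w t) (ts4 t)"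
    unfolding if_cancel by blast
  have "(step C X (machine n))\<^sup>+\<^sup>+ (a\<^sub>0, ts) (a\<^sub>0, ts4)"
    using 1(1) 2 3(1) 4(1) 5(1)
    by (meson rtranclp_trans tranclp_rtranclp_tranclp tranclp.trancl_into_trancl)
  moreover have "sem cN w 2 = s'" "sem cN w 8 = 0" using w j by (simp_all add: cN)
  ultimately show ?thesis using 5(2) by blast
qed

lemma halting_run:
  assumes "\<forall>t. counter (v t) (ts t)" "H (v 2) = 0"
  shows "\<exists>ts'. (step C X (machine n))\<^sup>*\<^sup>* (a\<^sub>0, ts) (Suc (a\<^sub>3 + n), ts') \<and> ones (ts' 0) = out (v 2)"
proof -
  obtain ts1 where
    1: "(step C X (machine n))\<^sup>+\<^sup>+ (a\<^sub>0, ts) (a\<^sub>2 + 1, ts1)" "\<forall>t. counter (sem cW v t) (ts1 t)"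
    using test_run[OF assms(1), of C X n] unfolding if_P[OF assms(2)] by blast
  define w where "w = sem cO (sem cW v)"
  from compile_correct[OF code(15) cO(1) 1(2)] obtain ts2 where
    2: "(step C X (machine n))\<^sup>*\<^sup>* (a\<^sub>2 + 1, ts1) (a\<^sub>3, ts2)" "\<forall>t. counter (w t) (ts2 t)"
    unfolding a\<^sub>3_def w_def by blast
  obtain tp where 3: "(step C X (machine n))\<^sup>*\<^sup>* (a\<^sub>3, ts2) (a\<^sub>3 + n, ts2(1 := tp))"
    using writer_run[of n n C X ts2] by blast
  have "scanned ((ts2(1 := tp)) 8)"
    using counter_scanned[of "w 8" "ts2 8"] 2(2) cO(3) by (simp add: w_def)
  then have 4: "step C X (machine n) (a\<^sub>3 + n, ts2(1 := tp)) (Suc (a\<^sub>3 + n),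
      (ts2(1 := tp))(8 := move_head Stay (write_cell True ((ts2(1 := tp)) 8))))"
    by (intro step_actI) (use code(17,18) in auto)
  have "ones (ts2 0) = out (v 2)"
    using counter_ones[OF 2(2)[rule_format]] by (simp add: w_def cO cW)
  moreover have "(step C X (machine n))\<^sup>*\<^sup>* (a\<^sub>0, ts) (Suc (a\<^sub>3 + n),
      (ts2(1 := tp))(8 := move_head Stay (write_cell True ((ts2(1 := tp)) 8))))"
    using 1(1) 2(1) 3 4 by (meson rtranclp.rtrancl_into_rtrancl rtranclp_trans tranclp_into_rtranclp)
  ultimately show ?thesis by (intro exI conjI) (assumption, simp)
qed

lemma machine_halts:
  assumes "(query_step C X H A B N)\<^sup>*\<^sup>* (I m n) s" "H s = 0"
  shows "halts_with C X (machine n) m (out s)"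
proof -
  from assms(1) have "\<exists>ts v. (step C X (machine n))\<^sup>*\<^sup>* (init_config m) (a\<^sub>0, ts) \<and>
      (\<forall>t. counter (v t) (ts t)) \<and> v 2 = s \<and> v 8 = 0"
  proof (induction rule: rtranclp_induct)
    case base
    then show ?case by (rule init_run)
  next
    case (step s s')
    then obtain ts v where "(Defs.step C X (machine n))\<^sup>*\<^sup>* (init_config m) (a\<^sub>0, ts)"
      "\<forall>t. counter (v t) (ts t)" "v 2 = s" "v 8 = 0" by blast
    with loop_run[of v ts C X s' n] step(2) show ?case
      by (metis rtranclp_trans tranclp_into_rtranclp)
  qed
  then obtain ts v where 1: "(step C X (machine n))\<^sup>*\<^sup>* (init_config m) (a\<^sub>0, ts)"
      "\<forall>t. counter (v t) (ts t)" "v 2 = s" by blast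
  with halting_run[OF 1(2)] assms(2) obtain ts' where
    "(step C X (machine n))\<^sup>*\<^sup>* (a\<^sub>0, ts) (Suc (a\<^sub>3 + n), ts')" "ones (ts' 0) = out s" by blast
  with 1(1) show ?thesis unfolding halts_with_def length_machine
    by (meson order_refl rtranclp_trans)
qed

lemma machine_runs_forever:
  assumes "c 0 = I m n" "\<And>i::nat. query_step C X H A B N (c i) (c (Suc i))"
  shows "runs_forever C X (machine n) m"
proof -
  define S where "S i d \<longleftrightarrow> (\<exists>(ts :: nat \<Rightarrow> tape) v. d = (a\<^sub>0, ts) \<and> (\<forall>t. counter (v t) (ts t)) \<and> v 2 = c i \<and> v 8 = 0)"
    for i d
  obtain ts where *: "(step C X (machine n))\<^sup>*\<^sup>* (init_config m) (a\<^sub>0, ts)" "S 0 (a\<^sub>0, ts)"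
    using init_run assms(1) unfolding S_def by metis
  show ?thesis unfolding runs_forever_def
  proof (rule infinite_chain_tranclp[where S = S, OF _ *])
    fix i d assume "S i d"
    then obtain ts v where "d = (a\<^sub>0, ts)" "\<forall>t. counter (v t) (ts t)" "v 2 = c i" "v 8 = 0"
      unfolding S_def by blast
    with loop_run[of v ts C X "c (Suc i)" n] assms(2)[of i]
    show "\<exists>y. (step C X (machine n))\<^sup>+\<^sup>+ d y \<and> S (Suc i) y" unfolding S_def by auto
  qed
qed

text \<open>The numbers undo \<open>decode_instr\<close>: 1 is odd and stands for the symbol 1, 0
  for \<open>Lft\<close>. They are explicit because the index must depend on the address in a
  primitive recursive way; for the fixed table any code will do, so \<open>table_codes\<close> is
  merely chosen.\<close>

definition writer_code :: "nat \<Rightarrow> nat" where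
  "writer_code a = (let x = prod_encode (1, prod_encode (0, Suc a))
     in 3 * prod_encode (1, prod_encode (x, x)))"

definition return_code :: "nat \<Rightarrow> nat" where
  "return_code a = 3 * prod_encode (8, prod_encode (prod_encode (0, prod_encode (2, 1)),
     prod_encode (1, prod_encode (2, Suc a))))"

text \<open>\<open>list_encode\<close> builds lists at the front, so the recursion assembles the
  program from its last instruction backwards: \<open>j\<close> counts the writer instructions
  already present.\<close>

definition suffix_code :: "nat \<Rightarrow> nat \<Rightarrow> nat" where
  "suffix_code j n = rec_nat (Suc (prod_encode (return_code (a\<^sub>3 + n), 0)))
     (\<lambda>j y. Suc (prod_encode (writer_code (a\<^sub>3 + (n - Suc j)), y))) j"

lemma suffix_code:
  "j \<le> n \<Longrightarrow> suffix_code j n =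
    list_encode (map (\<lambda>i. writer_code (a\<^sub>3 + i)) [n - j..<n] @ [return_code (a\<^sub>3 + n)])"
proof (induction j)
  case (Suc j)
  then have "[n - Suc j..<n] = (n - Suc j) # [n - j..<n]"
    by (metis Suc_diff_Suc Suc_le_lessD diff_less_Suc less_Suc_eq_0_disj diff_less upt_conv_Cons
        zero_less_Suc less_le_trans)
  with Suc show ?case by (simp add: suffix_code_def)
qed (simp add: suffix_code_def)

lemma prim_rec_suffix_code: "prim_rec 1 (\<lambda>xs. suffix_code (xs ! 0) (xs ! 0))"
  by (rule prim_rec_rec2[where f = suffix_code
        and h = "\<lambda>n. Suc (prod_encode (return_code (a\<^sub>3 + n), 0))"
        and g = "\<lambda>y j n. Suc (prod_encode (writer_code (a\<^sub>3 + (n - Suc j)), y))"])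
    (auto simp: suffix_code_def return_code_def writer_code_def Let_def intro!: prim_rec_intros)

definition table_codes :: "nat list" where
  "table_codes = (SOME cs. map decode_instr cs = table)"

definition machine_index :: "nat \<Rightarrow> nat" where
  "machine_index n = list_encode (table_codes @ map (\<lambda>i. writer_code (a\<^sub>3 + i)) [0..<n]
     @ [return_code (a\<^sub>3 + n)])"

lemma program_of_machine_index: "program_of (machine_index n) = machine n"
proof -
  have "\<exists>cs. map decode_instr cs = table"
    using surj_decode_instr by (metis ex_map_conv surj_def)
  then have "map decode_instr table_codes = table"
    unfolding table_codes_def by (rule someI_ex)
  moreover have "decode_instr (writer_code a) = Act 1 (True, Lft, Suc a) (True, Lft, Suc a)"
    "decode_instr (return_code a) = Act 8 (False, Stay, 1) (True, Stay, Suc a)" for a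
    by (simp_all add: decode_instr_def decode_action_def decode_dir_def writer_code_def
        return_code_def Let_def)
  ultimately show ?thesis
    by (simp add: program_of_def machine_index_def machine_def writer_def)
qed

lemma prim_rec_machine_index: "prim_rec 1 (\<lambda>xs. machine_index (xs ! 0))"
proof -
  have "machine_index n = list_encode (table_codes @ list_decode (suffix_code n n))" for n
    by (simp add: machine_index_def suffix_code)
  moreover have "prim_rec 1 (\<lambda>xs. list_encode (table_codes @ list_decode (suffix_code (xs ! 0) (xs ! 0))))"
    by (rule prim_rec_list_encode_append) (simp add: prim_rec_suffix_code[unfolded One_nat_def])
  ultimately show ?thesis by simp
qed

end

text \<open>All oracles and inputs are served by one \<open>q\<close>, and the program learns the
  parameter \<open>n\<close> only through its index. This uniformity is what later makes the code
  for the decided relation a recursive function of the given codes.\<close>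

definition realizes :: "(nat \<Rightarrow> nat) \<Rightarrow> (nat \<Rightarrow> nat \<Rightarrow> nat) \<Rightarrow> (nat \<Rightarrow> nat) \<Rightarrow> (nat \<Rightarrow> nat) \<Rightarrow>
    (nat \<Rightarrow> nat) \<Rightarrow> (nat \<Rightarrow> nat \<Rightarrow> nat) \<Rightarrow> (nat \<Rightarrow> nat) \<Rightarrow> bool" where
  "realizes q I H A B N out \<longleftrightarrow>
    (\<forall>C X m n s. (query_step C X H A B N)\<^sup>*\<^sup>* (I m n) s \<longrightarrow> H s = 0 \<longrightarrow>
      halts_with C X (program_of (q n)) m (out s)) \<and>
    (\<forall>C X m n c. c 0 = I m n \<longrightarrow> (\<forall>i::nat. query_step C X H A B N (c i) (c (Suc i))) \<longrightarrow>
      runs_forever C X (program_of (q n)) m)"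

theorem query_machine_exists:
  assumes I: "prim_rec 2 (\<lambda>xs. I (xs ! 0) (xs ! 1))" and H: "prim_rec 1 (\<lambda>xs. H (xs ! 0))"
    and A: "prim_rec 1 (\<lambda>xs. A (xs ! 0))" and B: "prim_rec 1 (\<lambda>xs. B (xs ! 0))"
    and N: "prim_rec 2 (\<lambda>xs. N (xs ! 0) (xs ! 1))" and out: "prim_rec 1 (\<lambda>xs. out (xs ! 0))"
  shows "\<exists>q. prim_rec 1 (\<lambda>xs. q (xs ! 0)) \<and> realizes q I H A B N out"
proof -
  have un: "\<exists>c. computes c 10 r (\<lambda>v. F (v 2))" if "prim_rec 1 (\<lambda>xs. F (xs ! 0))" "r < 10" "r \<noteq> 2"
    for F r using prim_rec_computes[OF that(1), of "[2]" 10 r] that(2,3) by simp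
  obtain cI where cI: "computes cI 10 2 (\<lambda>v. I (v 0) (v 1))"
    using prim_rec_computes[OF I, of "[0, 1]" 10 2] by auto
  obtain cH where cH: "computes cH 10 3 (\<lambda>v. H (v 2))" using un[OF H, of 3] by auto
  obtain cA where cA: "computes cA 10 4 (\<lambda>v. A (v 2))" using un[OF A, of 4] by auto
  obtain cB where cB: "computes cB 10 5 (\<lambda>v. B (v 2))" using un[OF B, of 5] by auto
  \<comment> \<open>Register 2 is an argument of \<open>N\<close>, so the new state is computed in
    register 7 and then copied back. The frontier 10 keeps the mark in register 8 intact.\<close>
  obtain cN where cN: "computes cN 10 7 (\<lambda>v. N (v 2) (v 6))"
    using prim_rec_computes[OF N, of "[2, 6]" 10 7] by auto
  obtain cO where cO: "computes cO 10 0 (\<lambda>v. out (v 2))" using un[OF out, of 0] by auto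
  note wf = computesD(1)[OF cI] computesD(1)[OF cH] computesD(1)[OF cA] computesD(1)[OF cB]
    computesD(1)[OF cN] computesD(1)[OF cO]
  note val = computesD(2)[OF cI] computesD(2)[OF cH] computesD(2)[OF cA] computesD(2)[OF cB]
    computesD(2)[OF cN] computesD(2)[OF cO]
  note keep = computesD(3)[OF cI] computesD(3)[OF cH] computesD(3)[OF cA] computesD(3)[OF cB]
    computesD(3)[OF cN] computesD(3)[OF cO]
  interpret query_machine I H A B N out cI "Seq cH (Seq cA (Seq cB (clear 6)))"
    "Seq cN (copy 10 7 2)" "Seq cO (Inc 8)"
    by unfold_locales (simp_all add: wf val keep copy)
  show ?thesis
    using prim_rec_machine_index machine_halts machine_runs_forever
    unfolding realizes_def
    by (intro exI[of _ machine_index]) (simp add: program_of_machine_index)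
qed

section \<open>Simulation of programs\<close>

text \<open>Binary, with the cell nearest to the head as the lowest bit: moving the head is halving
  one number and doubling the other, and blanks beyond the last 1 do not affect the code.\<close>

fun bits_code :: "bool list \<Rightarrow> nat" where
  "bits_code [] = 0"
| "bits_code (b # bs) = of_bool b + 2 * bits_code bs"

fun tape_code :: "tape \<Rightarrow> nat" where
  "tape_code (ls, rs) = prod_encode (bits_code ls, bits_code rs)"

lemma hd_blank_bits_code: "hd_blank bs \<longleftrightarrow> odd (bits_code bs)"
  by (cases bs) (auto simp: hd_blank_def)

lemma bits_code_tl: "bits_code (tl bs) = bits_code bs div 2"
  by (cases bs) auto

lemma bits_code_replicate: "bits_code (replicate m True) = 2 ^ m - 1"
proof (induction m)
  case (Suc m)
  obtain k where "2 ^ m = Suc k" by (metis not0_implies_Suc power_not_zero zero_neq_numeral)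
  then show ?case using Suc by simp
qed simp

definition popcount_step :: "nat \<Rightarrow> nat" where
  "popcount_step x = prod_encode (pfst x + psnd x mod 2, psnd x div 2)"

text \<open>Halving \<open>n\<close> reaches 0 within \<open>n\<close> rounds and surplus rounds
  change nothing, so \<open>n\<close> itself bounds the iteration.\<close>

definition popcount :: "nat \<Rightarrow> nat" where
  "popcount n = pfst ((popcount_step ^^ n) (prod_encode (0, n)))"

lemma popcount_iterate:
  "bits_code bs \<le> k \<Longrightarrow> (popcount_step ^^ k) (prod_encode (a, bits_code bs)) =
    prod_encode (a + count_list bs True, 0)"
proof (induction bs arbitrary: a k)
  case Nil
  show ?case by (induction k) (simp_all add: popcount_step_def)
next
  case (Cons b bs)
  show ?case
  proof (cases k)
    case 0
    then show ?thesis using Cons.IH[of 0 a] Cons.prems by auto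
  next
    case (Suc l)
    then have "bits_code bs \<le> l" using Cons.prems by (cases b) auto
    moreover have "popcount_step (prod_encode (a, bits_code (b # bs))) =
        prod_encode (a + of_bool b, bits_code bs)"
      by (cases b) (auto simp: popcount_step_def)
    ultimately show ?thesis using Cons.IH[of l "a + of_bool b"]
      unfolding Suc funpow_Suc_right comp_apply by auto
  qed
qed

lemma popcount_bits_code: "popcount (bits_code bs) = count_list bs True"
  by (simp add: popcount_def popcount_iterate)

definition tape_ones :: "nat \<Rightarrow> nat" where
  "tape_ones n = popcount (pfst n) + popcount (psnd n)"

lemma tape_ones: "tape_ones (tape_code tp) = ones tp"
  by (cases tp) (simp add: tape_ones_def popcount_bits_code)

definition act_tape :: "nat \<Rightarrow> nat \<Rightarrow> nat" where
  "act_tape a n = (let l = pfst n; r = (if odd (pfst a) then 1 else 0) + 2 * (psnd n div 2) in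
     if pfst (psnd a) mod 3 = 0 then prod_encode (l div 2, l mod 2 + 2 * r)
     else if pfst (psnd a) mod 3 = 1 then prod_encode (r mod 2 + 2 * l, r div 2)
     else prod_encode (l, r))"

lemma decode_action_eq: "decode_action a = (odd (pfst a), decode_dir (pfst (psnd a)), psnd (psnd a))"
  by (simp add: decode_action_def pfst_def psnd_def case_prod_beta)

lemma act_tape:
  assumes "decode_action a = (w, d, q)"
  shows "act_tape a (tape_code tp) = tape_code (move_head d (write_cell w tp))"
proof -
  obtain ls rs where tp: "tp = (ls, rs)" by fastforce
  have *: "of_bool (hd_blank bs) = bits_code bs mod 2" for bs
    by (simp add: hd_blank_bits_code mod2_eq_if)
  have "w = odd (pfst a)" "d = decode_dir (pfst (psnd a))" using assms by (simp_all add: decode_action_eq)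
  moreover have "hd_blank (w # tl rs) = w" by (simp add: hd_blank_def)
  ultimately show ?thesis
    by (auto simp: tp act_tape_def Let_def decode_dir_def * bits_code_tl)
qed

section \<open>Infinitely many tapes in a finite store\<close>

definition store_upd :: "nat \<Rightarrow> nat \<Rightarrow> nat \<Rightarrow> nat" where
  "store_upd t n st = Suc (prod_encode (prod_encode (t, n), st))"

definition lookup_step :: "nat \<Rightarrow> nat" where
  "lookup_step x = (if psnd x = 0 then x else if pfst (pfst (psnd x - 1)) = pfst x then x
     else prod_encode (pfst x, psnd (psnd x - 1)))"

text \<open>An exhausted store is 0, and \<open>0 - 1 = 0\<close> makes the value read there 0,
  which is the code of the blank tape. So tapes that were never touched need no entry.\<close>

definition lookup :: "nat \<Rightarrow> nat \<Rightarrow> nat" where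
  "lookup t st = psnd (pfst (psnd ((lookup_step ^^ st) (prod_encode (t, st))) - 1))"

lemma funpow_fixpoint: "f x = x \<Longrightarrow> (f ^^ n) x = x"
  by (induction n) auto

text \<open>Every step that does not stop passes to a strictly smaller store code. Hence the store
  bounds the number of steps, and surplus ones are idle.\<close>

lemma lookup_iterate:
  "st \<le> n \<Longrightarrow> (lookup_step ^^ n) (prod_encode (t, st)) = (lookup_step ^^ st) (prod_encode (t, st))"
proof (induction st arbitrary: n rule: less_induct)
  case (less st)
  show ?case
  proof (cases "lookup_step (prod_encode (t, st)) = prod_encode (t, st)")
    case False
    define r where "r = psnd (st - 1)"
    have st: "st \<noteq> 0" and eq: "lookup_step (prod_encode (t, st)) = prod_encode (t, r)"
      using False by (auto simp: lookup_step_def r_def split: if_splits)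
    have "r \<le> st - 1"
      using le_prod_encode_2[of r "pfst (st - 1)"] encode_pfst_psnd[of "st - 1"] by (simp add: r_def)
    moreover obtain n' where n: "n = Suc n'" using st less.prems by (cases n) auto
    ultimately have "r < st" "r \<le> n'" "r \<le> st - 1" using st less.prems by auto
    then have "(lookup_step ^^ n') (prod_encode (t, r)) = (lookup_step ^^ (st - 1)) (prod_encode (t, r))"
      using less.IH[of r n'] less.IH[of r "st - 1"] by simp
    then have "(lookup_step ^^ Suc n') (prod_encode (t, st)) =
        (lookup_step ^^ Suc (st - 1)) (prod_encode (t, st))"
      unfolding funpow_Suc_right comp_apply eq .
    then show ?thesis using n st by simp
  qed (simp add: funpow_fixpoint)
qed

lemma lookup_0 [simp]: "lookup t 0 = 0"
  by (simp add: lookup_def)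

lemma lookup_store_upd [simp]: "lookup t (store_upd u n st) = (if t = u then n else lookup t st)"
proof (cases "t = u")
  case True
  then have "lookup_step (prod_encode (t, store_upd u n st)) = prod_encode (t, store_upd u n st)"
    by (simp add: lookup_step_def store_upd_def)
  then show ?thesis using True by (simp add: lookup_def funpow_fixpoint) (simp add: store_upd_def)
next
  case False
  define p where "p = prod_encode (prod_encode (u, n), st)"
  have "lookup_step (prod_encode (t, Suc p)) = prod_encode (t, st)"
    using False by (simp add: lookup_step_def p_def)
  then have "(lookup_step ^^ Suc p) (prod_encode (t, Suc p)) = (lookup_step ^^ p) (prod_encode (t, st))"
    unfolding funpow_Suc_right comp_apply by simp
  also have "\<dots> = (lookup_step ^^ st) (prod_encode (t, st))"
    by (rule lookup_iterate) (simp add: p_def le_prod_encode_2)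
  finally show ?thesis using False unfolding lookup_def store_upd_def p_def by simp
qed

definition drop_code :: "nat \<Rightarrow> nat \<Rightarrow> nat" where
  "drop_code q e = ((\<lambda>l. psnd (l - 1)) ^^ q) e"

lemma drop_code: "drop_code q (list_encode xs) = list_encode (drop q xs)"
proof (induction q arbitrary: xs)
  case (Suc q)
  then show ?case
    by (cases xs) (simp_all add: drop_code_def funpow_Suc_right funpow_fixpoint del: funpow.simps)
qed (simp add: drop_code_def)

text \<open>
  A configuration is coded as \<open>\<langle>e, q, st\<rangle>\<close> with \<open>e\<close> the index of the program, \<open>q\<close> the state
  and \<open>st\<close> a list of tape updates, the latest first. Every step is presented as a query step:
  \<open>Act\<close> asks a trivial question and \<open>Oracle\<close> asks a program that reads the oracle. These
  are the \<^emph>\<open>basic\<close> configurations; their queries never freeze.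
\<close>

definition conf_rest :: "nat \<Rightarrow> nat" where
  "conf_rest c = drop_code (pfst (psnd c)) (pfst c)"

definition conf_instr :: "nat \<Rightarrow> nat" where "conf_instr c = pfst (conf_rest c - 1)"
definition arg1 :: "nat \<Rightarrow> nat" where "arg1 c = pfst (conf_instr c div 3)"
definition arg2 :: "nat \<Rightarrow> nat" where "arg2 c = pfst (psnd (conf_instr c div 3))"
definition arg3 :: "nat \<Rightarrow> nat" where "arg3 c = psnd (psnd (conf_instr c div 3))"
definition conf_tape :: "nat \<Rightarrow> nat \<Rightarrow> nat" where "conf_tape c t = lookup t (psnd (psnd c))"

text \<open>State 2 lies past the end and halts, state 1 loops, so the program converges exactly
  where the oracle is 1. The oracle bit thereby arrives as the answer to a query, and
  \<open>conf_next\<close> need not mention \<open>X\<close>.\<close>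

definition oracle_reader :: nat where
  "oracle_reader =
     (SOME e. program_of e = [Oracle 0 2 1, Act 0 (False, Stay, 1) (True, Stay, 1)])"

definition conf_kind :: "nat \<Rightarrow> nat" where
  "conf_kind c = (if conf_instr c mod 3 = 0 then 0 else if conf_instr c mod 3 = 1 then 0 else 1)"

definition query_prog :: "nat \<Rightarrow> nat" where
  "query_prog c = (if conf_instr c mod 3 = 0 then 0 else if conf_instr c mod 3 = 1 then oracle_reader
     else tape_ones (conf_tape c (arg1 c)))"

definition query_input :: "nat \<Rightarrow> nat" where
  "query_input c = (if conf_instr c mod 3 = 0 then 0
     else if conf_instr c mod 3 = 1 then tape_ones (conf_tape c (arg1 c))
     else tape_ones (conf_tape c (arg2 c)))"

definition conf_action :: "nat \<Rightarrow> nat" where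
  "conf_action c = (if odd (psnd (conf_tape c (arg1 c))) then arg3 c else arg2 c)"

definition conf_next :: "nat \<Rightarrow> nat \<Rightarrow> nat" where
  "conf_next c a = prod_encode (pfst c,
     if conf_instr c mod 3 = 0 then prod_encode (psnd (psnd (conf_action c)),
       store_upd (arg1 c) (act_tape (conf_action c) (conf_tape c (arg1 c))) (psnd (psnd c)))
     else if conf_instr c mod 3 = 1 then prod_encode (if a = 0 then arg2 c else arg3 c, psnd (psnd c))
     else prod_encode (if a = 0 then pfst (arg3 c) else psnd (arg3 c), psnd (psnd c)))"

definition conf_init :: "nat \<Rightarrow> nat \<Rightarrow> nat" where
  "conf_init e m = prod_encode (e, prod_encode (0, store_upd 0 (prod_encode (0, 2 ^ m - 1)) 0))"

lemma prim_rec_conf_rest [prim_rec_intros]: "prim_rec k a \<Longrightarrow> prim_rec k (\<lambda>xs. conf_rest (a xs))"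
  unfolding conf_rest_def drop_code_def by (intro prim_rec_intros prim_rec_iterate)

lemma prim_rec_tape_ones [prim_rec_intros]: "prim_rec k a \<Longrightarrow> prim_rec k (\<lambda>xs. tape_ones (a xs))"
  unfolding tape_ones_def popcount_def popcount_step_def by (intro prim_rec_intros prim_rec_iterate)

lemma prim_rec_lookup [prim_rec_intros]:
  "prim_rec k a \<Longrightarrow> prim_rec k b \<Longrightarrow> prim_rec k (\<lambda>xs. lookup (a xs) (b xs))"
  unfolding lookup_def lookup_step_def by (intro prim_rec_intros prim_rec_iterate)

lemma prim_rec_conf_arg [prim_rec_intros]:
  assumes "prim_rec k a"
  shows "prim_rec k (\<lambda>xs. conf_instr (a xs))" "prim_rec k (\<lambda>xs. arg1 (a xs))"
    "prim_rec k (\<lambda>xs. arg2 (a xs))" "prim_rec k (\<lambda>xs. arg3 (a xs))"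
  unfolding conf_instr_def arg1_def arg2_def arg3_def by (intro prim_rec_intros assms)+

lemma prim_rec_conf_tape [prim_rec_intros]:
  "prim_rec k a \<Longrightarrow> prim_rec k b \<Longrightarrow> prim_rec k (\<lambda>xs. conf_tape (a xs) (b xs))"
  unfolding conf_tape_def by (intro prim_rec_intros)

lemma prim_rec_act_tape [prim_rec_intros]:
  "prim_rec k a \<Longrightarrow> prim_rec k b \<Longrightarrow> prim_rec k (\<lambda>xs. act_tape (a xs) (b xs))"
  unfolding act_tape_def Let_def by (intro prim_rec_intros)

lemma prim_rec_conf [prim_rec_intros]:
  assumes "prim_rec k a"
  shows "prim_rec k (\<lambda>xs. conf_kind (a xs))" "prim_rec k (\<lambda>xs. query_prog (a xs))"
    "prim_rec k (\<lambda>xs. query_input (a xs))" "prim_rec k (\<lambda>xs. conf_action (a xs))"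
  unfolding conf_kind_def query_prog_def query_input_def conf_action_def
  by (intro prim_rec_intros assms)+

lemma prim_rec_conf_next [prim_rec_intros]:
  "prim_rec k a \<Longrightarrow> prim_rec k b \<Longrightarrow> prim_rec k (\<lambda>xs. conf_next (a xs) (b xs))"
  unfolding conf_next_def store_upd_def by (intro prim_rec_intros)

lemma prim_rec_conf_init [prim_rec_intros]:
  "prim_rec k a \<Longrightarrow> prim_rec k b \<Longrightarrow> prim_rec k (\<lambda>xs. conf_init (a xs) (b xs))"
  unfolding conf_init_def store_upd_def by (intro prim_rec_intros)

definition represents :: "nat \<Rightarrow> nat \<Rightarrow> config \<Rightarrow> bool" where
  "represents e c cf \<longleftrightarrow> pfst c = e \<and> pfst (psnd c) = fst cf \<and> (\<forall>t. conf_tape c t = tape_code (snd cf t))"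

lemma represents_init: "represents e (conf_init e m) (init_config m)"
proof -
  have "prod_encode (0, 0) = 0" by (simp add: prod_encode_def)
  then show ?thesis
    by (auto simp: represents_def conf_init_def init_config_def conf_tape_def bits_code_replicate)
qed

lemma conf_rest:
  "conf_rest c = list_encode (drop (pfst (psnd c)) (list_decode (pfst c)))"
  unfolding conf_rest_def by (metis drop_code list_decode_inverse)

text \<open>This lets \<open>conf_rest\<close> serve as the halting flag: the remaining instruction
  list is coded by 0 exactly when it is empty.\<close>

lemma conf_rest_eq_0: "represents e c (q, ts) \<Longrightarrow> conf_rest c = 0 \<longleftrightarrow> length (program_of e) \<le> q"
proof -
  have "list_encode xs = 0 \<longleftrightarrow> xs = []" for xs by (cases xs) auto
  then show "represents e c (q, ts) \<Longrightarrow> conf_rest c = 0 \<longleftrightarrow> length (program_of e) \<le> q"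
    by (auto simp: conf_rest represents_def program_of_def)
qed

lemma conf_instr:
  assumes "represents e c (q, ts)" "conf_rest c \<noteq> 0"
  shows "q < length (program_of e)" "program_of e ! q = decode_instr (conf_instr c)"
proof -
  show q: "q < length (program_of e)" using conf_rest_eq_0[OF assms(1)] assms(2) by simp
  then have "drop q (list_decode e) = list_decode e ! q # drop (Suc q) (list_decode e)"
    by (simp add: program_of_def Cons_nth_drop_Suc)
  then have "conf_instr c = list_decode e ! q"
    using assms(1) by (simp add: conf_instr_def conf_rest represents_def)
  then show "program_of e ! q = decode_instr (conf_instr c)"
    using q by (simp add: program_of_def)
qed

lemma decode_conf_instr:
  "decode_instr (conf_instr c) =
    (if conf_instr c mod 3 = 0 then Act (arg1 c) (decode_action (arg2 c)) (decode_action (arg3 c))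
     else if conf_instr c mod 3 = 1 then Oracle (arg1 c) (arg2 c) (arg3 c)
     else Query (arg1 c) (arg2 c) (pfst (arg3 c)) (psnd (arg3 c)))"
  by (simp add: decode_instr_def arg1_def arg2_def arg3_def pfst_def psnd_def case_prod_beta Let_def)

lemma halts_with_empty: "halts_with C X [] m m"
proof -
  have "ones (snd (init_config m) 0) = m"
    using counter_ones[of m "([], replicate m True)"] by (auto simp: init_config_def intro: exI[of _ 0])
  then show ?thesis unfolding halts_with_def
    by (intro exI[of _ "fst (init_config m)"] exI[of _ "snd (init_config m)"]) auto
qed

lemma I_infty_Down: "halts_with I_infty X (program_of e) m k \<Longrightarrow> ((e, m, X), (Down, enat k)) \<in> I_infty"
  by (subst I_infty_unfold) (auto simp: fb_op_def)

lemma I_infty_Up: "runs_forever I_infty X (program_of e) m \<Longrightarrow> ((e, m, X), (Up, \<infinity>)) \<in> I_infty"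
  by (subst I_infty_unfold) (auto simp: fb_op_def)

lemma trivial_query: "((0, m, X), (Down, enat m)) \<in> I_infty"
  using I_infty_Down[of X 0 m m] halts_with_empty by (simp add: program_of_def)

lemma oracle_reader: "\<exists>k. ((oracle_reader, n, X), (if X n then Down else Up, k)) \<in> I_infty"
proof -
  have "\<exists>e. program_of e = [Oracle 0 2 1, Act 0 (False, Stay, 1) (True, Stay, 1)]"
    using surj_program_of by (metis surjD)
  then have p: "program_of oracle_reader = [Oracle 0 2 1, Act 0 (False, Stay, 1) (True, Stay, 1)]"
    unfolding oracle_reader_def by (rule someI_ex)
  obtain ts where ts: "init_config n = (0, ts)" "ones (ts 0) = n"
    using counter_ones[of n "([], replicate n True)"] by (auto simp: init_config_def intro: exI[of _ 0])
  have 1: "step I_infty X (program_of oracle_reader) (init_config n) (if X n then 2 else 1, ts)"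
    unfolding p ts(1) using step_oracle[of 0 _ 0 2 1 I_infty X ts] ts(2) by simp
  show ?thesis
  proof (cases "X n")
    case True
    with 1 have "halts_with I_infty X (program_of oracle_reader) n (ones (ts 0))"
      unfolding halts_with_def by (intro exI[of _ 2] exI[of _ ts]) (auto simp: p)
    then show ?thesis using True by simp (blast dest: I_infty_Down)
  next
    case False
    have loop: "\<exists>ts'. step I_infty X (program_of oracle_reader) (1, ts) (1, ts')" for ts
      using step_actI[of 1 "program_of oracle_reader" 0 "(False, Stay, 1)" "(True, Stay, 1)" ts
          "scanned (ts 0)" Stay 1] by (cases "scanned (ts 0)") (auto simp: p)
    have "runs_forever I_infty X (program_of oracle_reader) n"
      unfolding runs_forever_def
      by (rule infinite_chain_tranclp[where S = "\<lambda>_ d. fst d = 1" and y = "(1, ts)"])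
        (use 1 False loop in \<open>force intro: tranclp.r_into_trancl\<close>)+
    then show ?thesis using False by simp (blast dest: I_infty_Up)
  qed
qed

abbreviation conf_step :: "oracle_set \<Rightarrow> nat \<Rightarrow> nat \<Rightarrow> bool" where
  "conf_step X \<equiv> query_step I_infty X conf_rest query_prog query_input conf_next"

lemma conf_step_simulates:
  assumes "represents e c cf" "conf_step X c c'"
  shows "\<exists>cf'. step I_infty X (program_of e) cf cf' \<and> represents e c' cf'"
proof -
  obtain q ts where cf: "cf = (q, ts)" by fastforce
  from assms(2) obtain j k where c: "conf_rest c \<noteq> 0"
    "((query_prog c, query_input c, X), (j, k)) \<in> I_infty" "c' = conf_next c (answer_code j)"
    unfolding query_step_def by blast
  note rep = assms(1)[unfolded cf]
  note p = conf_instr[OF rep c(1), unfolded decode_conf_instr]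
  have e: "pfst c = e" and tape: "conf_tape c t = tape_code (ts t)" for t
    using rep by (auto simp: represents_def)
  consider "conf_instr c mod 3 = 0" | "conf_instr c mod 3 = 1"
    | "conf_instr c mod 3 \<noteq> 0" "conf_instr c mod 3 \<noteq> 1" by blast
  then show ?thesis
  proof cases
    case 1
    let ?t = "arg1 c"
    obtain w d q' where a: "decode_action (conf_action c) = (w, d, q')" by (metis prod_cases3)
    have "scanned (ts ?t) \<longleftrightarrow> odd (psnd (conf_tape c ?t))"
      unfolding tape by (cases "ts ?t") (simp add: hd_blank_bits_code)
    then have sc: "(if scanned (ts ?t) then decode_action (arg3 c) else decode_action (arg2 c)) = (w, d, q')"
      using a by (auto simp: conf_action_def split: if_splits)
    have "step I_infty X (program_of e) (q, ts) (q', ts(?t := move_head d (write_cell w (ts ?t))))"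
      by (rule step_actI) (use p sc 1 in simp_all)
    moreover have "psnd (psnd (conf_action c)) = q'" using a by (simp add: decode_action_eq)
    then have "represents e c' (q', ts(?t := move_head d (write_cell w (ts ?t))))"
      using 1 c(3) act_tape[OF a] tape
      by (auto simp: represents_def conf_next_def e conf_tape_def)
    ultimately show ?thesis unfolding cf by blast
  next
    case 2
    have "ones (ts (arg1 c)) = query_input c" "query_prog c = oracle_reader"
      using 2 by (simp_all add: query_input_def query_prog_def tape tape_ones)
    \<comment> \<open>\<open>I_infty\<close> is functional, so the answer received is the one that
      the reader is known to give, namely the oracle bit.\<close>
    with oracle_reader[of "query_input c" X] c(2) have j: "j = (if X (ones (ts (arg1 c))) then Down else Up)"
      using I_infty_functional by fastforce
    have "step I_infty X (program_of e) (q, ts) (if X (ones (ts (arg1 c))) then arg2 c else arg3 c, ts)"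
      using step_oracle[OF p(1)] p(2) 2 by simp
    moreover have "represents e c' (if X (ones (ts (arg1 c))) then arg2 c else arg3 c, ts)"
      using 2 c(3) j tape by (auto simp: represents_def conf_next_def e conf_tape_def)
    ultimately show ?thesis unfolding cf by blast
  next
    case 3
    have "ones (ts (arg1 c)) = query_prog c" "ones (ts (arg2 c)) = query_input c"
      using 3 by (simp_all add: query_input_def query_prog_def tape tape_ones)
    then have "step I_infty X (program_of e) (q, ts)
        (case j of Down \<Rightarrow> pfst (arg3 c) | Up \<Rightarrow> psnd (arg3 c), ts)"
      using step_query[OF p(1), of "arg1 c" "arg2 c" _ _ ts X j k I_infty] p(2) 3 c(2) by simp
    moreover have "represents e c' (case j of Down \<Rightarrow> pfst (arg3 c) | Up \<Rightarrow> psnd (arg3 c), ts)"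
      using 3 c(3) tape by (cases j) (auto simp: represents_def conf_next_def e conf_tape_def)
    ultimately show ?thesis unfolding cf by blast
  qed
qed

lemma conf_steps_simulate:
  assumes "(conf_step X)\<^sup>*\<^sup>* (conf_init e m) c"
  shows "\<exists>cf. (step I_infty X (program_of e))\<^sup>*\<^sup>* (init_config m) cf \<and> represents e c cf"
  using assms
proof (induction rule: rtranclp_induct)
  case base
  then show ?case using represents_init by blast
next
  case (step c c')
  then show ?case using conf_step_simulates by (meson rtranclp.rtrancl_into_rtrancl)
qed

lemma conf_halts:
  assumes "(conf_step X)\<^sup>*\<^sup>* (conf_init e m) c" "conf_rest c = 0"
  shows "\<exists>k. ((e, m, X), (Down, k)) \<in> I_infty"
proof -
  obtain q ts where "(step I_infty X (program_of e))\<^sup>*\<^sup>* (init_config m) (q, ts)" "represents e c (q, ts)"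
    using conf_steps_simulate[OF assms(1)] by auto
  then have "halts_with I_infty X (program_of e) m (ones (ts 0))"
    using conf_rest_eq_0 assms(2) unfolding halts_with_def by blast
  then show ?thesis using I_infty_Down by blast
qed

lemma conf_runs_forever:
  assumes "(conf_step X)\<^sup>*\<^sup>* (conf_init e m) c" "S c"
    and "\<And>c. S c \<Longrightarrow> \<exists>c'. conf_step X c c' \<and> S c'"
  shows "\<exists>k. ((e, m, X), (Up, k)) \<in> I_infty"
proof -
  obtain cf where cf: "(step I_infty X (program_of e))\<^sup>*\<^sup>* (init_config m) cf" "represents e c cf"
    using conf_steps_simulate[OF assms(1)] by blast
  have "runs_forever I_infty X (program_of e) m" unfolding runs_forever_def
  proof (rule infinite_chain_tranclp[where S = "\<lambda>_ cf. \<exists>c. S c \<and> represents e c cf", OF _ cf(1)])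
    fix n :: nat and cf assume "\<exists>c. S c \<and> represents e c cf"
    then show "\<exists>cf'. (step I_infty X (program_of e))\<^sup>+\<^sup>+ cf cf' \<and> (\<exists>c. S c \<and> represents e c cf')"
      using assms(3) conf_step_simulates by (meson tranclp.r_into_trancl)
  qed (use cf assms(2) in blast)
  then show ?thesis using I_infty_Up by blast
qed

lemma basic_query: "conf_kind c = 0 \<Longrightarrow> \<exists>v. ((query_prog c, query_input c, X), v) \<in> I_infty"
  using trivial_query oracle_reader
  by (auto simp: conf_kind_def query_prog_def split: if_splits) blast

text \<open>The well-foundedness behind the whole argument: a computation that is settled from
  \<open>C\<close> asks only queries already settled in \<open>C\<close>. As
  \<open>C \<subseteq> I_infty\<close> and steps are deterministic, the simulated run follows the
  run in \<open>C\<close>, which at \<open>c\<close> has not halted and so must be able to take its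
  query step.\<close>

lemma reachable_query:
  assumes C: "C \<subseteq> I_infty" and x: "((e, m, X), v) \<in> fb_op C"
    and c: "(conf_step X)\<^sup>*\<^sup>* (conf_init e m) c" "conf_rest c \<noteq> 0" "conf_kind c \<noteq> 0"
  shows "\<exists>w. ((query_prog c, query_input c, X), w) \<in> C"
proof -
  let ?P = "program_of e"
  \<comment> \<open>The run in \<open>C\<close> from \<open>cf\<close> never freezes. By determinism
    the property passes from one configuration of the simulated run to the next.\<close>
  define good where "good cf \<longleftrightarrow>
      (\<exists>q ts. (step C X ?P)\<^sup>*\<^sup>* cf (q, ts) \<and> length ?P \<le> q) \<or>
      (\<exists>c. c 0 = cf \<and> (\<forall>n::nat. step C X ?P (c n) (c (Suc n))))" for cf
  obtain cf where cf: "(step I_infty X ?P)\<^sup>*\<^sup>* (init_config m) cf" "represents e c cf"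
    using conf_steps_simulate[OF c(1)] by blast
  have "good (init_config m)"
    using x by (auto simp: fb_op_def good_def halts_with_def runs_forever_def)
  from cf(1) this have "good cf"
  proof (induction rule: rtranclp_induct)
    case (step cf cf')
    have det: "d = cf'" if "Defs.step C X ?P cf d" for d
      using step_deterministic[OF that step(2)] C I_infty_functional by blast
    from step have "good cf" by simp
    then consider (halts) q ts where "(Defs.step C X ?P)\<^sup>*\<^sup>* cf (q, ts)" "length ?P \<le> q"
      | (forever) c where "c 0 = cf" "\<forall>n::nat. Defs.step C X ?P (c n) (c (Suc n))"
      unfolding good_def by blast
    then show ?case
    proof cases
      case halts
      then show ?thesis
        using det step(2) not_step_halted unfolding good_def by (metis converse_rtranclpE)
    next
      case forever
      then have "c 1 = cf'" using det by (metis One_nat_def)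
      then show ?thesis using forever(2) unfolding good_def by (intro disjI2 exI[of _ "\<lambda>n. c (Suc n)"]) auto
    qed
  qed
  obtain q ts where q: "cf = (q, ts)" by fastforce
  note rep = cf(2)[unfolded q]
  note p = conf_instr[OF rep c(2), unfolded decode_conf_instr]
  from \<open>good cf\<close> p(1) obtain cf' where "step C X ?P (q, ts) cf'"
    unfolding good_def q by (metis converse_rtranclpE not_le prod.inject)
  moreover have "?P ! q = Query (arg1 c) (arg2 c) (pfst (arg3 c)) (psnd (arg3 c))"
    "ones (ts (arg1 c)) = query_prog c" "ones (ts (arg2 c)) = query_input c"
    using p(2) c(3) rep
    by (auto simp: conf_kind_def query_prog_def query_input_def represents_def tape_ones split: if_splits)
  ultimately show ?thesis by (cases rule: step.cases) auto
qed

lemma realizes_Down: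
  assumes "realizes q I H A B N out" "(query_step I_infty X H A B N)\<^sup>*\<^sup>* (I m n) s" "H s = 0"
  shows "((q n, m, X), (Down, enat (out s))) \<in> I_infty"
  using assms I_infty_Down unfolding realizes_def by simp

lemma realizes_Up:
  assumes "realizes q I H A B N out" "S (I m n)"
    and "\<And>s. S s \<Longrightarrow> \<exists>s'. (query_step I_infty X H A B N)\<^sup>+\<^sup>+ s s' \<and> S s'"
  shows "((q n, m, X), (Up, \<infinity>)) \<in> I_infty"
proof -
  obtain c where "c 0 = I m n" "\<forall>i::nat. query_step I_infty X H A B N (c i) (c (Suc i))"
    using infinite_chain_tranclp[where S = "\<lambda>_. S", OF assms(3) rtranclp.rtrancl_refl assms(2)]
    by blast
  then have "runs_forever I_infty X (program_of (q n)) m"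
    using assms(1) unfolding realizes_def by simp
  then show ?thesis by (rule I_infty_Up)
qed

section \<open>The race of two computations\<close>

definition race_state :: "nat \<Rightarrow> nat \<Rightarrow> nat \<Rightarrow> nat \<Rightarrow> nat \<Rightarrow> nat" where
  "race_state p w z a b = prod_encode (p, prod_encode (w, prod_encode (z, prod_encode (a, b))))"

definition race_mode :: "nat \<Rightarrow> nat" where "race_mode s = pfst (psnd s)"
definition race_self :: "nat \<Rightarrow> nat" where "race_self s = pfst (psnd (psnd s))"
definition race_left :: "nat \<Rightarrow> nat" where "race_left s = pfst (psnd (psnd (psnd s)))"
definition race_right :: "nat \<Rightarrow> nat" where "race_right s = psnd (psnd (psnd (psnd s)))"

lemma race_state_simps [simp]:
  "pfst (race_state p w z a b) = p" "race_mode (race_state p w z a b) = w"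
  "race_self (race_state p w z a b) = z" "race_left (race_state p w z a b) = a"
  "race_right (race_state p w z a b) = b"
  by (simp_all add: race_state_def race_mode_def race_self_def race_left_def race_right_def)

text \<open>
  \<open>race_state p w z a b\<close>: phase \<open>p\<close>, with 4 for halting; index \<open>z\<close> of the race machine itself;
  configurations \<open>a\<close> and \<open>b\<close> of the two computations. In mode \<open>w = 0\<close> only \<open>a\<close> is advanced,
  and the machine halts once \<open>a\<close> is blocked by the pending query of \<open>b\<close>. In mode \<open>w = 1\<close> the
  machine first asks at each round whether this restricted race converges; if it diverges, then so
  does the first computation.
\<close>

definition race_prog :: "nat \<Rightarrow> nat" where
  "race_prog s =
    (if pfst s = 0 then if conf_rest (race_left s) = 0 then 0 else if conf_rest (race_right s) = 0 then 0
       else if race_mode s = 0 then 0 else race_self s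
     else if pfst s = 1 then if conf_kind (race_left s) = 0 then 0
       else if conf_kind (race_right s) = 0 then 0 else race_self s
     else if pfst s = 2 then query_prog (race_left s)
     else if race_mode s = 0 then 0 else query_prog (race_right s))"

definition race_input :: "nat \<Rightarrow> nat" where
  "race_input s =
    (if pfst s = 0 then race_state 0 0 (race_self s) (race_left s) (race_right s)
     else if pfst s = 1 then race_state 0 1 (race_self s)
       (conf_init (query_prog (race_left s)) (query_input (race_left s)))
       (conf_init (query_prog (race_right s)) (query_input (race_right s)))
     else if pfst s = 2 then query_input (race_left s)
     else query_input (race_right s))"

definition race_goto :: "nat \<Rightarrow> nat \<Rightarrow> nat" where
  "race_goto s p = prod_encode (p, psnd s)"

lemma race_goto [simp]: "race_goto (race_state p w z a b) p' = race_state p' w z a b"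
  by (simp add: race_goto_def race_state_def)

text \<open>Phase 0 is the start of a round, phase 1 chooses the side to move, phases 2 and 3 move
  the left and the right one. If the right configuration has halted and the left has not, phase 0
  repeats its state: divergence is the verdict in favour of the second computation.\<close>

definition race_next :: "nat \<Rightarrow> nat \<Rightarrow> nat" where
  "race_next s x =
    (if pfst s = 0 then if conf_rest (race_left s) = 0 then race_goto s 4
       else if conf_rest (race_right s) = 0 then s
       else if race_mode s = 0 then race_goto s 1 else if x = 0 then race_goto s 1 else race_goto s 4
     else if pfst s = 1 then if conf_kind (race_left s) = 0 then race_goto s 2
       else if conf_kind (race_right s) = 0 then race_goto s 3
       else if x = 0 then race_goto s 2 else race_goto s 3
     else if pfst s = 2 then
       race_state 0 (race_mode s) (race_self s) (conf_next (race_left s) x) (race_right s)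
     else if race_mode s = 0 then race_goto s 4
     else race_state 0 (race_mode s) (race_self s) (race_left s) (conf_next (race_right s) x))"

definition race_halt :: "nat \<Rightarrow> nat" where
  "race_halt s = (if pfst s = 4 then 0 else 1)"

abbreviation race_step :: "oracle_set \<Rightarrow> nat \<Rightarrow> nat \<Rightarrow> bool" where
  "race_step X \<equiv> query_step I_infty X race_halt race_prog race_input race_next"

lemma prim_rec_race_state [prim_rec_intros]:
  assumes "prim_rec k p" "prim_rec k w" "prim_rec k z" "prim_rec k a" "prim_rec k b"
  shows "prim_rec k (\<lambda>xs. race_state (p xs) (w xs) (z xs) (a xs) (b xs))"
  unfolding race_state_def by (intro prim_rec_intros assms)

lemma prim_rec_race_fields [prim_rec_intros]:
  assumes "prim_rec k s"
  shows "prim_rec k (\<lambda>xs. race_mode (s xs))" "prim_rec k (\<lambda>xs. race_self (s xs))"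
    "prim_rec k (\<lambda>xs. race_left (s xs))" "prim_rec k (\<lambda>xs. race_right (s xs))"
  unfolding race_mode_def race_self_def race_left_def race_right_def by (intro prim_rec_intros assms)+

lemma prim_rec_race:
  "prim_rec 1 (\<lambda>xs. race_halt (xs ! 0))" "prim_rec 1 (\<lambda>xs. race_prog (xs ! 0))"
  "prim_rec 1 (\<lambda>xs. race_input (xs ! 0))" "prim_rec 2 (\<lambda>xs. race_next (xs ! 0) (xs ! 1))"
  unfolding race_halt_def race_prog_def race_input_def race_next_def race_goto_def
  by (intro prim_rec_intros)+

definition race_family :: "nat \<Rightarrow> nat" where
  "race_family = (SOME q. realizes q (\<lambda>m n. m) race_halt race_prog race_input race_next (\<lambda>s. 0))"

definition race_index :: nat where "race_index = race_family 0"

lemma race_family: "realizes race_family (\<lambda>m n. m) race_halt race_prog race_input race_next (\<lambda>s. 0)"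
proof -
  have "prim_rec 2 (\<lambda>xs. (\<lambda>m n. m) (xs ! 0) (xs ! 1))" "prim_rec 1 (\<lambda>xs. (\<lambda>s. 0) (xs ! 0))"
    by (auto intro: prim_rec_intros)
  from query_machine_exists[OF this(1) prim_rec_race this(2)]
  have "\<exists>q. realizes q (\<lambda>m n. m) race_halt race_prog race_input race_next (\<lambda>s. 0)" by blast
  then show ?thesis unfolding race_family_def by (rule someI_ex)
qed

lemma race_halts: "(race_step X)\<^sup>*\<^sup>* s t \<Longrightarrow> race_halt t = 0 \<Longrightarrow>
    \<exists>k. ((race_index, s, X), (Down, k)) \<in> I_infty"
  unfolding race_index_def using realizes_Down[OF race_family] by blast

lemma race_runs_forever:
  assumes "\<And>s. S s \<Longrightarrow> \<exists>s'. (race_step X)\<^sup>+\<^sup>+ s s' \<and> S s'" "S s"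
  shows "\<exists>k. ((race_index, s, X), (Up, k)) \<in> I_infty"
  unfolding race_index_def using realizes_Up[OF race_family, of S] assms by blast

definition settled :: "oracle_set \<Rightarrow> nat \<Rightarrow> nat \<Rightarrow> bool" where
  "settled X e m \<longleftrightarrow> (\<exists>v. ((e, m, X), v) \<in> I_infty)"

definition race_ok :: "oracle_set \<Rightarrow> nat \<Rightarrow> nat \<Rightarrow> nat \<Rightarrow> nat \<Rightarrow> bool" where
  "race_ok X e m e' m' \<longleftrightarrow> (\<exists>j k.
     ((race_index, race_state 0 1 race_index (conf_init e m) (conf_init e' m'), X), (j, k)) \<in> I_infty \<and>
     (j = Down \<longrightarrow> settled X e m) \<and> (j = Up \<longrightarrow> settled X e' m'))"

lemma race_stepI:
  assumes "((race_prog s, race_input s, X), (j, k)) \<in> I_infty" "pfst s \<noteq> 4"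
    "s' = race_next s (answer_code j)"
  shows "race_step X s s'"
  using assms unfolding query_step_def race_halt_def by auto

lemma race_step_trivial:
  assumes "race_prog s = 0" "pfst s \<noteq> 4" "s' = race_next s 0"
  shows "race_step X s s'"
  by (rule race_stepI[of s X Down]) (use assms trivial_query in auto)

text \<open>The hypothesis is what the induction on \<open>I_infty\<close> will supply for pending
  queries; nothing is assumed about the two computations themselves. Basic configurations are
  excluded since the machine advances them without consulting itself.\<close>

locale race =
  fixes X :: oracle_set and e m e' m' :: nat
  assumes ok: "\<And>a b. \<lbrakk>(conf_step X)\<^sup>*\<^sup>* (conf_init e m) a; (conf_step X)\<^sup>*\<^sup>* (conf_init e' m') b;
      conf_rest a \<noteq> 0; conf_rest b \<noteq> 0; conf_kind a \<noteq> 0; conf_kind b \<noteq> 0\<rbrakk> \<Longrightarrow>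
      race_ok X (query_prog a) (query_input a) (query_prog b) (query_input b)"
begin

abbreviation st :: "nat \<Rightarrow> nat \<Rightarrow> nat \<Rightarrow> nat \<Rightarrow> nat" where
  "st p w \<equiv> race_state p w race_index"

abbreviation left :: "nat \<Rightarrow> bool" where "left \<equiv> (conf_step X)\<^sup>*\<^sup>* (conf_init e m)"
abbreviation right :: "nat \<Rightarrow> bool" where "right \<equiv> (conf_step X)\<^sup>*\<^sup>* (conf_init e' m')"

text \<open>The quantifier over \<open>w\<close> says that both modes advance the left configuration
  in the same way, as phases 1 and 2 do not branch on the mode. They part only in the rounds
  described by \<open>yields\<close>. This is why the restricted race predicts the full one.\<close>

definition advances :: "nat \<Rightarrow> nat \<Rightarrow> nat \<Rightarrow> bool" where
  "advances b a a' \<longleftrightarrow> conf_rest a \<noteq> 0 \<and> conf_step X a a' \<and>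
     (\<forall>w. (race_step X)\<^sup>+\<^sup>+ (st 1 w a b) (st 0 w a' b))"

definition yields :: "nat \<Rightarrow> nat \<Rightarrow> bool" where
  "yields b a \<longleftrightarrow> conf_rest a \<noteq> 0 \<and> (race_step X)\<^sup>*\<^sup>* (st 1 0 a b) (st 4 0 a b) \<and>
     (\<exists>b'. conf_step X b b' \<and> (race_step X)\<^sup>+\<^sup>+ (st 1 1 a b) (st 0 1 a b'))"

lemma settled_conf_step:
  assumes "conf_rest c \<noteq> 0" "settled X (query_prog c) (query_input c)"
  obtains j k where "((query_prog c, query_input c, X), (j, k)) \<in> I_infty"
    "conf_step X c (conf_next c (answer_code j))"
  using assms unfolding query_step_def settled_def by (metis surj_pair)

lemma settled_basic: "conf_kind c = 0 \<Longrightarrow> settled X (query_prog c) (query_input c)"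
  unfolding settled_def by (rule basic_query)

lemma round:
  assumes "left a" "right b" and r: "conf_rest a \<noteq> 0" "conf_rest b \<noteq> 0"
  shows "(\<exists>a'. advances b a a') \<or> yields b a"
proof -
  have "\<exists>p. (\<forall>w. race_step X (st 1 w a b) (st p w a b)) \<and>
      (p = 2 \<and> settled X (query_prog a) (query_input a) \<or>
       p = 3 \<and> settled X (query_prog b) (query_input b))"
  proof -
    consider "conf_kind a = 0" | "conf_kind a \<noteq> 0" "conf_kind b = 0"
      | "conf_kind a \<noteq> 0" "conf_kind b \<noteq> 0" by blast
    then show ?thesis
    proof cases
      case 1
      then have "race_step X (st 1 w a b) (st 2 w a b)" for w
        by (intro race_step_trivial) (simp_all add: race_prog_def race_next_def)
      then show ?thesis using settled_basic[OF 1] by blast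
    next
      case 2
      then have "race_step X (st 1 w a b) (st 3 w a b)" for w
        by (intro race_step_trivial) (simp_all add: race_prog_def race_next_def)
      then show ?thesis using settled_basic[OF 2(2)] by blast
    next
      case 3
      with ok[OF assms] obtain j k where j: "((race_index, st 0 1 (conf_init (query_prog a) (query_input a))
          (conf_init (query_prog b) (query_input b)), X), (j, k)) \<in> I_infty"
        "j = Down \<longrightarrow> settled X (query_prog a) (query_input a)"
        "j = Up \<longrightarrow> settled X (query_prog b) (query_input b)"
        unfolding race_ok_def by blast
      define p :: nat where "p = (case j of Down \<Rightarrow> 2 | Up \<Rightarrow> 3)"
      have "race_step X (st 1 w a b) (st p w a b)" for w
        by (rule race_stepI[of _ X j k])
          (use 3 j(1) in \<open>auto simp: race_prog_def race_input_def race_next_def p_def split: answer.split\<close>)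
      then show ?thesis using j(2,3) by (intro exI[of _ p]) (cases j; simp add: p_def)
    qed
  qed
  then obtain p where p: "\<And>w. race_step X (st 1 w a b) (st p w a b)"
    "p = 2 \<and> settled X (query_prog a) (query_input a) \<or>
     p = 3 \<and> settled X (query_prog b) (query_input b)" by blast
  from p(2) show ?thesis
  proof
    assume 2: "p = 2 \<and> settled X (query_prog a) (query_input a)"
    then obtain j k where j: "((query_prog a, query_input a, X), (j, k)) \<in> I_infty"
      "conf_step X a (conf_next a (answer_code j))" using settled_conf_step[OF r(1)] by blast
    have "race_step X (st 2 w a b) (st 0 w (conf_next a (answer_code j)) b)" for w
      by (rule race_stepI[of _ X j k]) (use j in \<open>auto simp: race_prog_def race_input_def race_next_def\<close>)
    with p(1) 2 have "(race_step X)\<^sup>+\<^sup>+ (st 1 w a b) (st 0 w (conf_next a (answer_code j)) b)" for w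
      by (metis tranclp.r_into_trancl tranclp.trancl_into_trancl)
    then show ?thesis using j(2) r(1) unfolding advances_def by blast
  next
    assume 3: "p = 3 \<and> settled X (query_prog b) (query_input b)"
    then obtain j k where j: "((query_prog b, query_input b, X), (j, k)) \<in> I_infty"
      "conf_step X b (conf_next b (answer_code j))" using settled_conf_step[OF r(2)] by blast
    have "race_step X (st 3 1 a b) (st 0 1 a (conf_next b (answer_code j)))"
      by (rule race_stepI[of _ X j k]) (use j in \<open>auto simp: race_prog_def race_input_def race_next_def\<close>)
    with p(1)[of 1] 3 have "(race_step X)\<^sup>+\<^sup>+ (st 1 1 a b) (st 0 1 a (conf_next b (answer_code j)))"
      by (metis tranclp.r_into_trancl tranclp.trancl_into_trancl)
    moreover have "race_step X (st 3 0 a b) (st 4 0 a b)"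
      by (rule race_step_trivial) (auto simp: race_prog_def race_next_def)
    with p(1)[of 0] 3 have "(race_step X)\<^sup>*\<^sup>* (st 1 0 a b) (st 4 0 a b)"
      by (metis r_into_rtranclp rtranclp.rtrancl_into_rtrancl)
    ultimately show ?thesis using j(2) r(1) unfolding yields_def by blast
  qed
qed

text \<open>Being inductive, it says that moving only the left configuration comes to an end after
  finitely many rounds; outside it such rounds can be continued forever.\<close>

inductive blocked :: "nat \<Rightarrow> nat \<Rightarrow> bool" for b where
  "conf_rest a = 0 \<Longrightarrow> blocked b a"
| "yields b a \<Longrightarrow> blocked b a"
| "advances b a a' \<Longrightarrow> blocked b a' \<Longrightarrow> blocked b a"

lemma step_finished: "conf_rest a = 0 \<Longrightarrow> race_step X (st 0 w a b) (st 4 w a b)"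
  by (rule race_step_trivial) (auto simp: race_prog_def race_next_def)

lemma step_restricted:
  "conf_rest a \<noteq> 0 \<Longrightarrow> conf_rest b \<noteq> 0 \<Longrightarrow> race_step X (st 0 0 a b) (st 1 0 a b)"
  by (rule race_step_trivial) (auto simp: race_prog_def race_next_def)

lemma blocked_Down:
  assumes "blocked b a" "conf_rest b \<noteq> 0"
  shows "\<exists>k. ((race_index, st 0 0 a b, X), (Down, k)) \<in> I_infty"
proof -
  have "\<exists>c. (race_step X)\<^sup>*\<^sup>* (st 0 0 a b) (st 4 0 c b)" using assms(1)
  proof (induction rule: blocked.induct)
    case (1 a)
    then show ?case using step_finished by blast
  next
    case (2 a)
    then have "conf_rest a \<noteq> 0" "(race_step X)\<^sup>*\<^sup>* (st 1 0 a b) (st 4 0 a b)"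
      by (auto simp: yields_def)
    then show ?case using step_restricted[of a b] assms(2) by (meson converse_rtranclp_into_rtranclp)
  next
    case (3 a a')
    then have "conf_rest a \<noteq> 0" "(race_step X)\<^sup>*\<^sup>* (st 1 0 a b) (st 0 0 a' b)"
      unfolding advances_def by (blast dest: tranclp_into_rtranclp)+
    then show ?case using 3(3) step_restricted[of a b] assms(2)
      by (meson converse_rtranclp_into_rtranclp rtranclp_trans)
  qed
  then show ?thesis using race_halts by (force simp: race_halt_def)
qed

text \<open>Outside \<open>blocked\<close> each round advances the left configuration to another one
  outside \<open>blocked\<close>. The same infinite chain is a divergent run of the restricted race
  and a divergent run of the first computation.\<close>

lemma not_blocked:
  assumes "left a" "right b" "conf_rest b \<noteq> 0" "\<not> blocked b a"
  shows "\<exists>k. ((race_index, st 0 0 a b, X), (Up, k)) \<in> I_infty" "settled X e m"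
proof -
  have adv: "\<exists>a'. advances b a a' \<and> left a' \<and> \<not> blocked b a'" if "left a" "\<not> blocked b a" for a
  proof -
    have "conf_rest a \<noteq> 0" "\<not> yields b a" using that(2) blocked.intros by blast+
    moreover from this(1) have "(\<exists>a'. advances b a a') \<or> yields b a"
      using round[OF that(1) assms(2)] assms(3) by blast
    ultimately obtain a' where "advances b a a'" by blast
    then show ?thesis using that blocked.intros(3) unfolding advances_def
      by (meson rtranclp.rtrancl_into_rtrancl)
  qed
  show "\<exists>k. ((race_index, st 0 0 a b, X), (Up, k)) \<in> I_infty"
  proof (rule race_runs_forever[where S = "\<lambda>s. \<exists>a. s = st 0 0 a b \<and> left a \<and> \<not> blocked b a"])
    fix s assume "\<exists>a. s = st 0 0 a b \<and> left a \<and> \<not> blocked b a"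
    then obtain a where a: "s = st 0 0 a b" "left a" "\<not> blocked b a" by blast
    from adv[OF a(2,3)] obtain a' where a': "advances b a a'" "left a'" "\<not> blocked b a'" by blast
    then have "(race_step X)\<^sup>+\<^sup>+ (st 1 0 a b) (st 0 0 a' b)" "conf_rest a \<noteq> 0"
      by (auto simp: advances_def)
    then have "(race_step X)\<^sup>+\<^sup>+ (st 0 0 a b) (st 0 0 a' b)"
      using step_restricted assms(3) by (meson tranclp_into_tranclp2)
    then show "\<exists>s'. (race_step X)\<^sup>+\<^sup>+ s s' \<and> (\<exists>a. s' = st 0 0 a b \<and> left a \<and> \<not> blocked b a)"
      using a(1) a' by blast
  qed (use assms in blast)
  have "\<exists>k. ((e, m, X), (Up, k)) \<in> I_infty"
    using adv by (intro conf_runs_forever[where S = "\<lambda>a. left a \<and> \<not> blocked b a", OF assms(1)])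
      (use assms in \<open>auto simp: advances_def\<close>)
  then show "settled X e m" unfolding settled_def by blast
qed

definition left_wins :: "nat \<Rightarrow> nat \<Rightarrow> bool" where
  "left_wins a b \<longleftrightarrow> settled X e m \<and> (\<exists>c d. (race_step X)\<^sup>*\<^sup>* (st 0 1 a b) (st 4 1 c d))"

lemma left_wins_rtranclp:
  "left_wins a' b' \<Longrightarrow> (race_step X)\<^sup>*\<^sup>* (st 0 1 a b) (st 0 1 a' b') \<Longrightarrow> left_wins a b"
  unfolding left_wins_def by (meson rtranclp_trans)

lemma left_wins_finished: "left a \<Longrightarrow> conf_rest a = 0 \<Longrightarrow> left_wins a b"
  using conf_halts step_finished unfolding left_wins_def settled_def by blast

lemma step_blocked:
  assumes "blocked b a" "conf_rest a \<noteq> 0" "conf_rest b \<noteq> 0"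
  shows "race_step X (st 0 1 a b) (st 1 1 a b)"
proof -
  obtain k where "((race_index, st 0 0 a b, X), (Down, k)) \<in> I_infty"
    using blocked_Down[OF assms(1,3)] by blast
  then show ?thesis
    by (intro race_stepI[of _ X Down k])
      (use assms in \<open>auto simp: race_prog_def race_input_def race_next_def\<close>)
qed

lemma left_wins_not_blocked:
  assumes "left a" "right b" "conf_rest a \<noteq> 0" "conf_rest b \<noteq> 0" "\<not> blocked b a"
  shows "left_wins a b"
proof -
  obtain k where "((race_index, st 0 0 a b, X), (Up, k)) \<in> I_infty"
    using not_blocked(1)[OF assms(1,2,4,5)] by blast
  then have "race_step X (st 0 1 a b) (st 4 1 a b)"
    by (intro race_stepI[of _ X Up k])
      (use assms in \<open>auto simp: race_prog_def race_input_def race_next_def\<close>)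
  then show ?thesis using not_blocked(2)[OF assms(1,2,4,5)] unfolding left_wins_def by blast
qed

text \<open>The full race asks the restricted one in every round. \<open>blocked\<close> persists
  along its own derivation, so the answer stays \<open>Down\<close> and the race goes on until the
  left side halts or the right side moves.\<close>

lemma blocked_progress:
  assumes "blocked b a" "left a" "conf_rest b \<noteq> 0"
  shows "left_wins a b \<or> (\<exists>a' b'. (race_step X)\<^sup>+\<^sup>+ (st 0 1 a b) (st 0 1 a' b') \<and> left a' \<and> conf_step X b b')"
  using assms(1,2)
proof (induction rule: blocked.induct)
  case (1 a)
  then show ?case using left_wins_finished by blast
next
  case (2 a)
  then obtain b' where b': "conf_rest a \<noteq> 0" "conf_step X b b'" "(race_step X)\<^sup>+\<^sup>+ (st 1 1 a b) (st 0 1 a b')"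
    unfolding yields_def by blast
  have "race_step X (st 0 1 a b) (st 1 1 a b)"
    using step_blocked[OF blocked.intros(2)] 2(1) b'(1) assms(3) by blast
  then have "(race_step X)\<^sup>+\<^sup>+ (st 0 1 a b) (st 0 1 a b')" using b'(3) by (rule tranclp_into_tranclp2)
  then show ?case using 2(2) b'(2) by blast
next
  case (3 a a')
  then have a': "conf_rest a \<noteq> 0" "conf_step X a a'" "(race_step X)\<^sup>+\<^sup>+ (st 1 1 a b) (st 0 1 a' b)"
    unfolding advances_def by auto
  then have "left a'" using 3(4) by simp
  have "race_step X (st 0 1 a b) (st 1 1 a b)"
    using step_blocked[OF blocked.intros(3)[OF 3(1,2)]] a'(1) assms(3) by blast
  then have *: "(race_step X)\<^sup>+\<^sup>+ (st 0 1 a b) (st 0 1 a' b)" using a'(3) by (rule tranclp_into_tranclp2)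
  from 3(3)[OF \<open>left a'\<close>] show ?case
  proof
    assume "left_wins a' b"
    then show ?thesis using left_wins_rtranclp * by (meson tranclp_into_rtranclp)
  next
    assume "\<exists>c b'. (race_step X)\<^sup>+\<^sup>+ (st 0 1 a' b) (st 0 1 c b') \<and> left c \<and> conf_step X b b'"
    then show ?thesis using * by (meson tranclp_trans)
  qed
qed

theorem race_ok: "race_ok X e m e' m'"
proof (cases "left_wins (conf_init e m) (conf_init e' m')")
  case True
  then show ?thesis
    using race_halts[of X _ "st 4 1 _ _"] unfolding left_wins_def race_ok_def
    by (fastforce simp: race_halt_def)
next
  case False
  \<comment> \<open>If the left side never wins, every finite stretch of the race either moves the
    right configuration one step or finds it halted and repeats the state. In both cases the race
    runs forever, and the second computation converges or diverges but does not freeze.\<close>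
  define S where "S a b \<longleftrightarrow> left a \<and> right b \<and> \<not> left_wins a b" for a b
  have init: "S (conf_init e m) (conf_init e' m')" using False by (simp add: S_def)
  have finished: "race_step X (st 0 1 a b) (st 0 1 a b)" if "S a b" "conf_rest b = 0" for a b
    by (rule race_step_trivial)
      (use that left_wins_finished[of a b] in \<open>auto simp: race_prog_def race_next_def S_def\<close>)
  have progress: "\<exists>a' b'. (race_step X)\<^sup>+\<^sup>+ (st 0 1 a b) (st 0 1 a' b') \<and> conf_step X b b' \<and> S a' b'"
    if "S a b" "conf_rest b \<noteq> 0" for a b
  proof -
    have "conf_rest a \<noteq> 0" "blocked b a"
      using that left_wins_finished left_wins_not_blocked unfolding S_def by blast+
    then have "\<exists>a' b'. (race_step X)\<^sup>+\<^sup>+ (st 0 1 a b) (st 0 1 a' b') \<and> left a' \<and> conf_step X b b'"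
      using blocked_progress[of b a] that unfolding S_def by blast
    then obtain a' b' where *: "(race_step X)\<^sup>+\<^sup>+ (st 0 1 a b) (st 0 1 a' b')" "left a'" "conf_step X b b'"
      by blast
    moreover have "\<not> left_wins a' b'"
      using *(1) left_wins_rtranclp that(1) unfolding S_def by (meson tranclp_into_rtranclp)
    ultimately show ?thesis using that(1) unfolding S_def by (meson rtranclp.rtrancl_into_rtrancl)
  qed
  have "\<exists>k. ((race_index, st 0 1 (conf_init e m) (conf_init e' m'), X), (Up, k)) \<in> I_infty"
    by (rule race_runs_forever[where S = "\<lambda>s. \<exists>a b. s = st 0 1 a b \<and> S a b"])
      (use init finished progress in \<open>blast intro: tranclp.r_into_trancl\<close>)+
  moreover have "settled X e' m'"
  proof (cases "\<exists>b. right b \<and> conf_rest b = 0")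
    case True
    then show ?thesis using conf_halts unfolding settled_def by blast
  next
    case False
    have "\<exists>k. ((e', m', X), (Up, k)) \<in> I_infty"
    proof (rule conf_runs_forever[where S = "\<lambda>b. \<exists>a. S a b", OF rtranclp.rtrancl_refl])
      fix b assume "\<exists>a. S a b"
      then show "\<exists>b'. conf_step X b b' \<and> (\<exists>a. S a b')"
        using progress False unfolding S_def by blast
    qed (use init in blast)
    then show ?thesis unfolding settled_def by blast
  qed
  ultimately show ?thesis unfolding race_ok_def by blast
qed

end

text \<open>Induction on \<open>I_infty\<close> with the claim for all opponents and both orders at
  once, since nothing is known about the opponent's pending queries. By
  \<open>reachable_query\<close> those of the settled side satisfy the claim already, which is
  enough for the locale hypothesis whichever side it is on.\<close>

lemma race_ok_if_settled:
  assumes "settled X e m"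
  shows "race_ok X e m e' m' \<and> race_ok X e' m' e m"
proof -
  define S where "S = {((e, m, X), v :: answer \<times> enat). \<forall>e' m'. race_ok X e m e' m' \<and> race_ok X e' m' e m}"
  have "fb_op (I_infty \<inter> S) \<subseteq> S"
  proof
    fix y assume y: "y \<in> fb_op (I_infty \<inter> S)"
    obtain e m X v where yv: "y = ((e, m, X), v)" by (metis prod_cases3 surj_pair)
    have S: "race_ok X (query_prog a) (query_input a) e' m' \<and> race_ok X e' m' (query_prog a) (query_input a)"
      if "(conf_step X)\<^sup>*\<^sup>* (conf_init e m) a" "conf_rest a \<noteq> 0" "conf_kind a \<noteq> 0" for a e' m'
      using reachable_query[OF _ y[unfolded yv] that] by (auto simp: S_def)
    have "race X e m e' m'" "race X e' m' e m" for e' m' by unfold_locales (simp_all add: S)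
    then show "y \<in> S" unfolding yv S_def using race.race_ok by blast
  qed
  then have "I_infty \<subseteq> S"
    unfolding I_infty_def by (intro lfp_induct[OF mono_fb_op])
  then show ?thesis using assms by (auto simp: settled_def S_def)
qed

section \<open>Deciding a relation\<close>

definition decide_code0 :: "nat \<Rightarrow> nat" where "decide_code0 s = pfst (psnd (psnd s))"
definition decide_code1 :: "nat \<Rightarrow> nat" where "decide_code1 s = psnd (psnd (psnd s))"
definition decide_input :: "nat \<Rightarrow> nat" where "decide_input s = pfst (psnd s)"

definition decide_init :: "nat \<Rightarrow> nat \<Rightarrow> nat" where
  "decide_init m n = prod_encode (0, prod_encode (m, n))"

definition decide_prog :: "nat \<Rightarrow> nat" where
  "decide_prog s = (if pfst s = 0 then race_index else if pfst s = 1 then decide_code0 s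
     else decide_code1 s)"

definition decide_arg :: "nat \<Rightarrow> nat" where
  "decide_arg s = (if pfst s = 0 then race_state 0 1 race_index
       (conf_init (decide_code0 s) (decide_input s)) (conf_init (decide_code1 s) (decide_input s))
     else decide_input s)"

text \<open>Phase 0 asks the race, phases 1 and 2 ask the first and the second code, phases 3 and 4
  halt with output 1 and 0. The answers are interchanged in phase 2 because the second code belongs
  to the complement.\<close>

definition decide_next :: "nat \<Rightarrow> nat \<Rightarrow> nat" where
  "decide_next s x = prod_encode
     (if pfst s = 0 then if x = 0 then 1 else 2
      else if pfst s = 1 then if x = 0 then 3 else 4 else if x = 0 then 4 else 3, psnd s)"

definition decide_halt :: "nat \<Rightarrow> nat" where
  "decide_halt s = (if pfst s = 3 then 0 else if pfst s = 4 then 0 else 1)"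

definition decide_out :: "nat \<Rightarrow> nat" where
  "decide_out s = (if pfst s = 3 then 1 else 0)"

lemma prim_rec_decide:
  "prim_rec 2 (\<lambda>xs. decide_init (xs ! 0) (xs ! 1))" "prim_rec 1 (\<lambda>xs. decide_halt (xs ! 0))"
  "prim_rec 1 (\<lambda>xs. decide_prog (xs ! 0))" "prim_rec 1 (\<lambda>xs. decide_arg (xs ! 0))"
  "prim_rec 2 (\<lambda>xs. decide_next (xs ! 0) (xs ! 1))" "prim_rec 1 (\<lambda>xs. decide_out (xs ! 0))"
  unfolding decide_init_def decide_halt_def decide_prog_def decide_arg_def decide_next_def
    decide_out_def decide_code0_def decide_code1_def decide_input_def
  by (intro prim_rec_intros)+

lemma decide_correct:
  assumes q: "realizes q decide_init decide_halt decide_prog decide_arg decide_next decide_out"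
    and R: "fb_semicomputable_code X e\<^sub>0 R" "fb_semicomputable_code X e\<^sub>1 (- R)"
  shows "fb_computable_code X (q (prod_encode (e\<^sub>0, e\<^sub>1))) R"
  unfolding fb_computable_code_def
proof
  fix m
  define st where "st p = prod_encode (p, prod_encode (m, prod_encode (e\<^sub>0, e\<^sub>1)))" for p
  let ?step = "query_step I_infty X decide_halt decide_prog decide_arg decide_next"
  have st: "pfst (st p) = p" "decide_code0 (st p) = e\<^sub>0" "decide_code1 (st p) = e\<^sub>1"
    "decide_input (st p) = m" for p
    by (simp_all add: st_def decide_code0_def decide_code1_def decide_input_def)
  have next_st: "decide_next (st p) x = st (if p = 0 then if x = 0 then 1 else 2
      else if p = 1 then if x = 0 then 3 else 4 else if x = 0 then 4 else 3)" for p x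
    by (simp add: decide_next_def st_def)
  have R0: "m \<in> R \<longleftrightarrow> fb_converges X e\<^sub>0 m" and R1: "m \<notin> R \<longleftrightarrow> fb_converges X e\<^sub>1 m"
    using R unfolding fb_semicomputable_code_def by blast+
  have conv: "fb_converges X e m \<longleftrightarrow> j = Down" if v: "((e, m, X), (j, k)) \<in> I_infty" for e j k
  proof (cases j)
    case Down
    have "k \<noteq> \<infinity>" using v Down by (subst (asm) I_infty_unfold) (auto simp: fb_op_def)
    then show ?thesis using v Down unfolding fb_converges_def fb_converges_to_def by auto
  next
    case Up
    then show ?thesis using I_infty_functional[OF v] unfolding fb_converges_def fb_converges_to_def
      by fastforce
  qed
  have "settled X e\<^sub>0 m \<or> settled X e\<^sub>1 m"
    using R0 R1 unfolding settled_def fb_converges_def fb_converges_to_def by blast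
  then have "race_ok X e\<^sub>0 m e\<^sub>1 m" using race_ok_if_settled by blast
  then obtain j k where race:
    "((race_index, race_state 0 1 race_index (conf_init e\<^sub>0 m) (conf_init e\<^sub>1 m), X), (j, k)) \<in> I_infty"
    "j = Down \<Longrightarrow> settled X e\<^sub>0 m" "j = Up \<Longrightarrow> settled X e\<^sub>1 m" unfolding race_ok_def by blast
  have first: "?step (st 0) (st (case j of Down \<Rightarrow> 1 | Up \<Rightarrow> 2))"
    unfolding query_step_def using race(1)
    by (auto simp: st next_st decide_halt_def decide_prog_def decide_arg_def split: answer.split
        intro!: exI[of _ j] exI[of _ k])
  have "?step (st (case j of Down \<Rightarrow> 1 | Up \<Rightarrow> 2)) (st (if m \<in> R then 3 else 4))"
  proof (cases j)
    case Down
    then obtain j' k' where "((e\<^sub>0, m, X), (j', k')) \<in> I_infty" using race(2) unfolding settled_def by auto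
    moreover from this have "m \<in> R \<longleftrightarrow> j' = Down" using R0 conv by simp
    ultimately show ?thesis unfolding query_step_def using Down
      by (cases j') (auto simp: st next_st decide_halt_def decide_prog_def decide_arg_def
          intro!: exI[of _ j'] exI[of _ k'])
  next
    case Up
    then obtain j' k' where "((e\<^sub>1, m, X), (j', k')) \<in> I_infty" using race(3) unfolding settled_def by auto
    moreover from this have "m \<notin> R \<longleftrightarrow> j' = Down" using R1 conv by simp
    ultimately show ?thesis unfolding query_step_def using Up
      by (cases j') (auto simp: st next_st decide_halt_def decide_prog_def decide_arg_def
          intro!: exI[of _ j'] exI[of _ k'])
  qed
  with first have "?step\<^sup>*\<^sup>* (decide_init m (prod_encode (e\<^sub>0, e\<^sub>1))) (st (if m \<in> R then 3 else 4))"
    by (simp add: decide_init_def flip: st_def)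
  from realizes_Down[OF q this]
  show "fb_converges_to X (q (prod_encode (e\<^sub>0, e\<^sub>1))) m (if m \<in> R then 1 else 0)"
    unfolding fb_converges_to_def by (auto simp: decide_halt_def decide_out_def st split: if_splits)
qed

section \<open>From a computable relation to semi-computable ones\<close>

fun redirect :: "(nat \<Rightarrow> nat) \<Rightarrow> instr \<Rightarrow> instr" where
  "redirect f (Act t (w, d, q) (w', d', q')) = Act t (w, d, f q) (w', d', f q')"
| "redirect f (Oracle t q q') = Oracle t (f q) (f q')"
| "redirect f (Query t u q q') = Query t u (f q) (f q')"

lemma step_redirect:
  assumes "step C X P (q, ts) (q', ts')"
  shows "step C X (map (redirect f) P @ Q) (q, ts) (f q', ts')"
  using assms
proof cases
  case (step_act t a\<^sub>0 a\<^sub>1 w d)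
  obtain w\<^sub>0 d\<^sub>0 q\<^sub>0 w\<^sub>1 d\<^sub>1 q\<^sub>1 where a: "a\<^sub>0 = (w\<^sub>0, d\<^sub>0, q\<^sub>0)" "a\<^sub>1 = (w\<^sub>1, d\<^sub>1, q\<^sub>1)" by (metis prod_cases3)
  show ?thesis unfolding step_act(1)
    by (rule step_actI) (use step_act a in \<open>auto simp: nth_append split: if_splits\<close>)
next
  case (step_oracle t q\<^sub>1 q\<^sub>0)
  then show ?thesis
    using step.step_oracle[of q "map (redirect f) P @ Q" t "f q\<^sub>1" "f q\<^sub>0" C X ts]
    by (auto simp: nth_append split: if_splits)
next
  case (step_query t u q\<^sub>d q\<^sub>u j k)
  then show ?thesis
    using step.step_query[of q "map (redirect f) P @ Q" t u "f q\<^sub>d" "f q\<^sub>u" ts X j k C]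
    by (cases j) (auto simp: nth_append)
qed

text \<open>A program may halt at any address from \<open>length P\<close> on. Capping all jump
  targets at \<open>length P\<close> makes every halting run arrive at the first appended
  instruction.\<close>

lemma halts_with_redirect:
  assumes "halts_with C X P m k"
  shows "\<exists>ts. (step C X (map (redirect (min (length P))) P @ Q))\<^sup>*\<^sup>* (init_config m) (length P, ts) \<and>
    ones (ts 0) = k"
proof -
  let ?P = "map (redirect (min (length P))) P @ Q"
  from assms obtain q ts where run: "(step C X P)\<^sup>*\<^sup>* (init_config m) (q, ts)"
    and q: "length P \<le> q" "ones (ts 0) = k" unfolding halts_with_def by blast
  have "(step C X ?P)\<^sup>*\<^sup>* (init_config m) (min (length P) (fst cf), snd cf)"
    if "(step C X P)\<^sup>*\<^sup>* (init_config m) cf" for cf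
    using that
  proof (induction rule: rtranclp_induct)
    case base
    then show ?case by (simp add: init_config_def fun_upd_def)
  next
    case (step cf cf')
    obtain q ts q' ts' where cf: "cf = (q, ts)" "cf' = (q', ts')" by (metis surj_pair)
    with step(2) have "q < length P" using not_step_halted by (meson not_le)
    then show ?case using step_redirect[OF step(2)[unfolded cf]] step(3)
      by (auto simp: cf intro: rtranclp.rtrancl_into_rtrancl)
  qed
  from this[OF run] q show ?thesis by (auto simp: min_def split: if_splits)
qed

text \<open>The number 1 codes the list with the single entry 0, and instruction 0 decodes to an
  action that leads back to state 0 whatever is scanned.\<close>

lemma query_one: "\<exists>k. ((1, m, X), (Up, k)) \<in> I_infty"
proof -
  have p: "program_of 1 = [Act 0 (False, Lft, 0) (False, Lft, 0)]"
  proof -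
    have z: "prod_decode 0 = (0, 0)" using pfst_psnd_0 by (simp add: pfst_def psnd_def prod_eq_iff)
    then show ?thesis
      by (simp add: program_of_def decode_instr_def decode_action_def decode_dir_def)
  qed
  obtain ts where ts: "init_config m = (0, ts)" by (simp add: init_config_def)
  have "runs_forever I_infty X (program_of 1) m" unfolding runs_forever_def
  proof (rule infinite_chain_tranclp[where S = "\<lambda>_ d. fst d = 0" and y = "(0, ts)"])
    fix d :: config assume "fst d = 0"
    then obtain ts where d: "d = (0, ts)" by (cases d) auto
    have "step I_infty X (program_of 1) d (0, ts(0 := move_head Lft (write_cell False (ts 0))))"
      unfolding d by (rule step_actI) (auto simp: p[unfolded One_nat_def])
    then show "\<exists>y. (step I_infty X (program_of 1))\<^sup>+\<^sup>+ d y \<and> fst y = 0" by fastforce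
  qed (simp_all add: ts)
  then show ?thesis using I_infty_Up by blast
qed

text \<open>
  The output 0 or 1 of a characteristic function, used both as an index and as an input, is a
  query that tells the two apart: program 0 halts at once, and program 1 runs forever.
\<close>

lemma semicomputable_if_computable_code:
  assumes "fb_computable_code X e R"
  shows "fb_semicomputable X {m. (m \<in> R) = b}"
proof -
  define P where "P = program_of e"
  define L where "L = length P"
  \<comment> \<open>Address \<open>L + 2\<close> lies past the end and halts, \<open>L + 1\<close>
    loops. The value of \<open>b\<close> decides which answer leads where, so that \<open>R\<close>
    and its complement are treated together.\<close>
  define Q where "Q = map (redirect (min L)) P @
    [Query 0 0 (if b then L + 1 else L + 2) (if b then L + 2 else L + 1),
     Act 0 (False, Stay, L + 1) (True, Stay, L + 1)]"
  obtain i where i: "program_of i = Q" using surj_program_of by (metis surjD)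
  have QL: "length Q = L + 2" "Q ! L = Query 0 0 (if b then L + 1 else L + 2) (if b then L + 2 else L + 1)"
    "Q ! (L + 1) = Act 0 (False, Stay, L + 1) (True, Stay, L + 1)"
    by (simp_all add: Q_def L_def nth_append)
  have out: "\<exists>ts. (step I_infty X Q)\<^sup>*\<^sup>* (init_config m) (if (m \<in> R) = b then L + 2 else L + 1, ts)" for m
  proof -
    let ?k = "if m \<in> R then 1 else 0 :: nat"
    have "((e, m, X), (Down, enat ?k)) \<in> I_infty"
      using assms unfolding fb_computable_code_def fb_converges_to_def by blast
    then have "halts_with I_infty X P m ?k"
      unfolding P_def by (subst (asm) I_infty_unfold) (auto simp: fb_op_def)
    from halts_with_redirect[OF this, folded L_def] obtain ts where
      ts: "(step I_infty X Q)\<^sup>*\<^sup>* (init_config m) (L, ts)" "ones (ts 0) = ?k" unfolding Q_def by blast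
    obtain l where l: "((?k, ?k, X), (if m \<in> R then Up else Down, l)) \<in> I_infty"
      using query_one[of 1 X] trivial_query[of 0 X] by (cases "m \<in> R") auto
    have "step I_infty X Q (L, ts) (case (if m \<in> R then Up else Down) of
        Down \<Rightarrow> (if b then L + 1 else L + 2) | Up \<Rightarrow> (if b then L + 2 else L + 1), ts)"
    proof (rule step_query)
      show "L < length Q" by (simp add: QL(1))
      show "Q ! L = Query 0 0 (if b then L + 1 else L + 2) (if b then L + 2 else L + 1)" by (rule QL(2))
      show "((ones (ts 0), ones (ts 0), X), (if m \<in> R then Up else Down, l)) \<in> I_infty"
        unfolding ts(2) by (rule l)
    qed
    then have 1: "(step I_infty X Q)\<^sup>*\<^sup>* (init_config m) (case (if m \<in> R then Up else Down) of
        Down \<Rightarrow> (if b then L + 1 else L + 2) | Up \<Rightarrow> (if b then L + 2 else L + 1), ts)"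
      by (rule rtranclp.rtrancl_into_rtrancl[OF ts(1)])
    have 2: "(case (if m \<in> R then Up else Down) of
        Down \<Rightarrow> (if b then L + 1 else L + 2) | Up \<Rightarrow> (if b then L + 2 else L + 1)) =
        (if (m \<in> R) = b then L + 2 else L + 1)" by simp
    show ?thesis using 1 unfolding 2 by blast
  qed
  have "(m \<in> R) = b \<longleftrightarrow> fb_converges X i m" for m
  proof (cases "(m \<in> R) = b")
    case True
    then obtain ts where "(step I_infty X Q)\<^sup>*\<^sup>* (init_config m) (L + 2, ts)" using out[of m] by auto
    then have "halts_with I_infty X (program_of i) m (ones (ts 0))"
      unfolding halts_with_def i QL(1) by blast
    then show ?thesis using True I_infty_Down unfolding fb_converges_def fb_converges_to_def by blast
  next
    case False
    then obtain ts where ts: "(step I_infty X Q)\<^sup>*\<^sup>* (init_config m) (L + 1, ts)" using out[of m] by auto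
    have "runs_forever I_infty X Q m" unfolding runs_forever_def
    proof (rule infinite_chain_tranclp[where S = "\<lambda>_ d. fst d = L + 1", OF _ ts])
      fix d :: config assume "fst d = L + 1"
      then obtain ts where d: "d = (L + 1, ts)" by (cases d) auto
      have "step I_infty X Q d (L + 1, ts(0 := move_head Stay (write_cell (scanned (ts 0)) (ts 0))))"
        unfolding d by (rule step_actI) (use QL in auto)
      then show "\<exists>y. (step I_infty X Q)\<^sup>+\<^sup>+ d y \<and> fst y = L + 1" by fastforce
    qed simp
    then have "((i, m, X), (Up, \<infinity>)) \<in> I_infty" using I_infty_Up i by simp
    then show ?thesis using False I_infty_functional unfolding fb_converges_def fb_converges_to_def
      by fastforce
  qed
  then show ?thesis unfolding fb_semicomputable_def fb_semicomputable_code_def by blast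
qed

theorem lemma2p33:
  fixes X :: "nat \<Rightarrow> bool"
  shows "(\<forall>R. fb_computable X R \<longleftrightarrow> fb_semicomputable X R \<and> fb_semicomputable X (- R)) \<and>
    (\<exists>h. recursive2 h \<and>
      (\<forall>R e\<^sub>0 e\<^sub>1. fb_semicomputable_code X e\<^sub>0 R \<and> fb_semicomputable_code X e\<^sub>1 (- R) \<longrightarrow>
         fb_computable_code X (h e\<^sub>0 e\<^sub>1) R))"
proof -
  \<comment> \<open>The pair of codes is the parameter of the decision machine, not part of its
    input, so its index is a primitive recursive function of them.\<close>
  obtain q where q: "prim_rec 1 (\<lambda>xs. q (xs ! 0))"
    "realizes q decide_init decide_halt decide_prog decide_arg decide_next decide_out"
    using query_machine_exists[OF prim_rec_decide] by blast
  define h where "h e\<^sub>0 e\<^sub>1 = q (prod_encode (e\<^sub>0, e\<^sub>1))" for e\<^sub>0 e\<^sub>1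
  have "prim_rec 2 (\<lambda>xs. prod_encode (xs ! 0, xs ! 1))" by (intro prim_rec_intros)
  from prim_rec_comp1[OF q(1) this] have "prim_rec 2 (\<lambda>xs. h (xs ! 0) (xs ! 1))"
    by (simp add: h_def)
  from prim_rec_recf[OF this] obtain r where
    r: "\<And>xs. length xs = 2 \<Longrightarrow> recf_eval r xs (h (xs ! 0) (xs ! 1))" by blast
  have "recf_eval r [a, b] (h a b)" for a b using r[of "[a, b]"] by simp
  then have rec: "recursive2 h" unfolding recursive2_def by blast
  have h: "fb_computable_code X (h e\<^sub>0 e\<^sub>1) R"
    if "fb_semicomputable_code X e\<^sub>0 R" "fb_semicomputable_code X e\<^sub>1 (- R)" for e\<^sub>0 e\<^sub>1 R
    unfolding h_def by (rule decide_correct[OF q(2) that])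
  have "fb_semicomputable X R \<and> fb_semicomputable X (- R)" if R: "fb_computable X R" for R
  proof -
    obtain e where "fb_computable_code X e R" using R unfolding fb_computable_def by blast
    from semicomputable_if_computable_code[OF this, of True]
      semicomputable_if_computable_code[OF this, of False]
    show ?thesis by (simp add: Compl_eq)
  qed
  then show ?thesis using rec h unfolding fb_computable_def fb_semicomputable_def by blast
qed

end
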